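(* Let $n\geq 3$ and let $CAG_n=\mathrm{Cay}(A_n,T_3)$ be the complete alternating group graph, where $T_3=\{(i,j,k),(i,k,j)\mid 1\leq i<j<k\leq n\}$ is the set of all 3-cycles. Then the two largest eigenvalues of $CAG_n$ are $\lambda_1(CAG_n)=2\binom{n}{3}$ and $\lambda_2(CAG_n)=\frac{1}{3}n(n-2)(n-4)$.
   Context: $A_n$ is the alternating group on $\{1,\ldots,n\}$; $(i,j,k)$ denotes the 3-cycle $i\mapsto j\mapsto k\mapsto i$. Products of permutations are read left to right: $\sigma\tau$ means first apply $\sigma$, then $\tau$. For a finite group $\Gamma$ with identity $e$ and a subset $T\subseteq\Gamma\setminus\{e\}$ with $T=T^{-1}$, the Cayley graph $\mathrm{Cay}(\Gamma,T)$ is the undirected graph with vertex set $\Gamma$ and edge set $\{\{\gamma,t\gamma\}\mid \gamma\in\Gamma,\ t\in T\}$. The eigenvalues of a graph $G$ on $N$ vertices are those of its adjacency matrix, listed with multiplicity as $\lambda_1(G)\geq\lambda_2(G)\geq\cdots\geq\lambda_N(G)$. *)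

theory Defs
  imports
    "HOL-Algebra.Sym_Groups"
    "Jordan_Normal_Form.Char_Poly"
begin

text \<open>A finite simple graph is given as the pair of its vertex set and its set of
  (two-element) edges.\<close>

type_synonym 'a graph = "'a set \<times> 'a set set"

text \<open>The Cayley graph is meant for a connection set \<open>T\<close> that does not contain the identity and
  is closed under inverses; for \<open>T_3\<close> this is proved below.\<close>

definition cayley_graph :: "('a, 'b) monoid_scheme \<Rightarrow> 'a set \<Rightarrow> 'a graph" where
  "cayley_graph G T = (carrier G, {{g, t \<otimes>\<^bsub>G\<^esub> g} | g t. g \<in> carrier G \<and> t \<in> T})"

definition adjacency_matrix :: "'a list \<Rightarrow> 'a set set \<Rightarrow> real mat" where
  "adjacency_matrix vs E = mat (length vs) (length vs)
     (\<lambda>(i, j). if {vs ! i, vs ! j} \<in> E then 1 else 0)"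

text \<open>The adjacency matrix needs an enumeration of the vertices; by
  \<open>graph_eigenvalues_enumeration\<close> below its choice is irrelevant.
  The adjacency matrix is real and symmetric, so all roots of its characteristic polynomial are
  real and it is enough to take \<open>proots\<close> over the reals.\<close>

definition graph_eigenvalues :: "'a graph \<Rightarrow> real list" where
  "graph_eigenvalues G =
     (let vs = (SOME vs. distinct vs \<and> set vs = fst G)
      in rev (sorted_list_of_multiset (proots (char_poly (adjacency_matrix vs (snd G))))))"

definition graph_eigenvalue :: "nat \<Rightarrow> 'a graph \<Rightarrow> real" where
  "graph_eigenvalue i G = graph_eigenvalues G ! (i - 1)"

text \<open>Permutations are multiplied from left to right, whereas \<open>alt_group\<close> uses \<open>(\<circ>)\<close>.\<close>

definition alternating_group :: "nat \<Rightarrow> (nat \<Rightarrow> nat) monoid" where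
  "alternating_group n = (alt_group n)\<lparr>mult := (\<lambda>\<sigma> \<tau>. \<tau> \<circ> \<sigma>)\<rparr>"

definition T\<^sub>3 :: "nat \<Rightarrow> (nat \<Rightarrow> nat) set" where
  "T\<^sub>3 n = (\<Union>{{cycle_of_list [i, j, k], cycle_of_list [i, k, j]} | i j k.
               1 \<le> i \<and> i < j \<and> j < k \<and> k \<le> n})"

definition CAG :: "nat \<Rightarrow> (nat \<Rightarrow> nat) graph" where
  "CAG n = cayley_graph (alternating_group n) (T\<^sub>3 n)"


lemma char_poly_adjacency_matrix_cong:
  assumes "distinct vs" "distinct ws" "set vs = set ws"
  shows "char_poly (adjacency_matrix vs E) = char_poly (adjacency_matrix ws E)"
proof -
  define n where "n = length vs"
  have "mset vs = mset ws"
    using assms by (simp add: set_eq_iff_mset_eq_distinct)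
  then obtain p where p: "p permutes {..<length ws}" "permute_list p ws = vs"
    using mset_eq_permutation[of vs ws] by blast
  have n: "length ws = n"
    using p by (auto simp: n_def)
  have p': "p permutes {0..<n}"
    using p n by (simp add: atLeast0LessThan)
  have p_lt: "p i < n" if "i < n" for i
    using permutes_in_image[OF p', of i] that by simp
  have vs_nth: "vs ! i = ws ! p i" if "i < n" for i
    using p n that by (metis permute_list_nth)
  define A where "A = char_poly_matrix (adjacency_matrix ws E)"
  define B where "B = mat n n (\<lambda>(i, j). A $$ (p i, j))"
  have A: "A \<in> carrier_mat n n"
    by (simp add: A_def char_poly_matrix_def adjacency_matrix_def n)
  have B: "B \<in> carrier_mat n n"
    by (simp add: B_def)
  have inj: "p i = p j \<longleftrightarrow> i = j" for i j
    using permutes_inj[OF p'] by (auto simp: inj_def)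
  have eq: "char_poly_matrix (adjacency_matrix vs E) =
      (mat n n (\<lambda>(i, j). (B\<^sup>T) $$ (p i, j)))\<^sup>T"
    by (rule eq_matI)
       (auto simp: char_poly_matrix_def adjacency_matrix_def B_def A_def n n_def[symmetric]
          p_lt vs_nth inj)
  have "char_poly (adjacency_matrix vs E) = det (mat n n (\<lambda>(i, j). (B\<^sup>T) $$ (p i, j)))"
    unfolding char_poly_def eq by (rule det_transpose[where n = n]) simp
  also have "\<dots> = signof p * det (B\<^sup>T)"
    using B p' by (intro det_permute_rows) auto
  also have "det (B\<^sup>T) = det B"
    using B by (rule det_transpose)
  also have "det B = signof p * det A"
    unfolding B_def using A p' by (rule det_permute_rows)
  also have "signof p * (signof p * det A) = det A"
    by (simp add: sign_def)
  finally show ?thesis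
    by (simp add: A_def char_poly_def)
qed

lemma graph_eigenvalues_enumeration:
  assumes "distinct vs" "set vs = V"
  shows "graph_eigenvalues (V, E) =
           rev (sorted_list_of_multiset (proots (char_poly (adjacency_matrix vs E))))"
proof -
  have "distinct (SOME vs. distinct vs \<and> set vs = V) \<and> set (SOME vs. distinct vs \<and> set vs = V) = V"
    using assms by (intro someI[of "\<lambda>vs. distinct vs \<and> set vs = V"]) simp
  then show ?thesis
    using char_poly_adjacency_matrix_cong[of "SOME vs. distinct vs \<and> set vs = V" vs E] assms
    by (simp add: graph_eigenvalues_def)
qed

lemma group_alternating_group: "group (alternating_group n)"
proof (rule groupI)
  fix x assume "x \<in> carrier (alternating_group n)"
  then have x: "x \<in> carrier (alt_group n)"
    by (simp add: alternating_group_def)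
  then have "x \<circ> inv' x = id"
    by (auto simp: alt_group_carrier intro: permutes_inv_o)
  then show "\<exists>y\<in>carrier (alternating_group n).
      y \<otimes>\<^bsub>alternating_group n\<^esub> x = \<one>\<^bsub>alternating_group n\<^esub>"
    using alt_group_inv_closed[OF x] by (auto simp: alternating_group_def alt_group_one)
next
  fix x y
  assume "x \<in> carrier (alternating_group n)" "y \<in> carrier (alternating_group n)"
  then have "y \<otimes>\<^bsub>alt_group n\<^esub> x \<in> carrier (alt_group n)"
    by (intro monoid.m_closed[OF group.is_monoid[OF alt_group_is_group]])
       (simp_all add: alternating_group_def)
  then show "x \<otimes>\<^bsub>alternating_group n\<^esub> y \<in> carrier (alternating_group n)"
    by (simp add: alternating_group_def alt_group_mult)
next
  show "\<one>\<^bsub>alternating_group n\<^esub> \<in> carrier (alternating_group n)"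
    using monoid.one_closed[OF group.is_monoid[OF alt_group_is_group[of n]]]
    by (simp add: alternating_group_def)
qed (simp_all add: alternating_group_def alt_group_one comp_assoc)

lemma T\<^sub>3_eq_three_cycles: "T\<^sub>3 n = three_cycles n"
proof (intro equalityI subsetI)
  fix s assume "s \<in> T\<^sub>3 n"
  then obtain i j k where ijk: "1 \<le> i" "i < j" "j < k" "k \<le> n"
    and "s = cycle_of_list [i, j, k] \<or> s = cycle_of_list [i, k, j]"
    unfolding T\<^sub>3_def by blast
  then consider "s = cycle_of_list [i, j, k]" | "s = cycle_of_list [i, k, j]"
    by blast
  then show "s \<in> three_cycles n"
  proof cases
    case 1
    then show ?thesis
      using ijk by (intro CollectI exI[of _ "[i, j, k]"]) auto
  next
    case 2
    then show ?thesis
      using ijk by (intro CollectI exI[of _ "[i, k, j]"]) auto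
  qed
next
  fix s assume "s \<in> three_cycles n"
  then obtain cs where cs: "s = cycle_of_list cs" "cycle cs" "length cs = 3" "set cs \<subseteq> {1..n}"
    by blast
  then obtain a b c where abc: "cs = [a, b, c]"
    by (auto simp: numeral_3_eq_3 length_Suc_conv)
  have rot: "cycle_of_list [a, b, c] = cycle_of_list [b, c, a]"
    "cycle_of_list [a, b, c] = cycle_of_list [c, a, b]"
    using cycle_of_list_rotate_independent[of "[a, b, c]" 1]
      cycle_of_list_rotate_independent[of "[a, b, c]" 2] cs abc
    by (simp_all add: numeral_2_eq_2)
  have T: "cycle_of_list [i, j, k] \<in> T\<^sub>3 n \<and> cycle_of_list [i, k, j] \<in> T\<^sub>3 n"
    if "1 \<le> i" "i < j" "j < k" "k \<le> n" for i j k
    unfolding T\<^sub>3_def using that by blast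
  have ne: "a \<noteq> b" "b \<noteq> c" "a \<noteq> c" and bd: "1 \<le> a" "1 \<le> b" "1 \<le> c" "a \<le> n" "b \<le> n" "c \<le> n"
    using cs abc by auto
  consider "a < b \<and> b < c" | "a < c \<and> c < b" | "b < a \<and> a < c" | "b < c \<and> c < a"
    | "c < a \<and> a < b" | "c < b \<and> b < a"
    using ne by linarith
  then show "s \<in> T\<^sub>3 n"
    unfolding cs(1) abc
  proof cases
    case 1 with T[of a b c] bd show "cycle_of_list [a, b, c] \<in> T\<^sub>3 n" by blast
  next
    case 2 with T[of a c b] bd show "cycle_of_list [a, b, c] \<in> T\<^sub>3 n" by blast
  next
    case 3 with T[of b a c] bd show "cycle_of_list [a, b, c] \<in> T\<^sub>3 n" unfolding rot(1) by blast
  next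
    case 4 with T[of b c a] bd show "cycle_of_list [a, b, c] \<in> T\<^sub>3 n" unfolding rot(1) by blast
  next
    case 5 with T[of c a b] bd show "cycle_of_list [a, b, c] \<in> T\<^sub>3 n" unfolding rot(2) by blast
  next
    case 6 with T[of c b a] bd show "cycle_of_list [a, b, c] \<in> T\<^sub>3 n" unfolding rot(2) by blast
  qed
qed

lemma T\<^sub>3_subset: "T\<^sub>3 n \<subseteq> carrier (alternating_group n) - {\<one>\<^bsub>alternating_group n\<^esub>}"
proof
  fix s assume "s \<in> T\<^sub>3 n"
  then obtain i j k where ijk: "i < j" "j < k"
    and s: "s = cycle_of_list [i, j, k] \<or> s = cycle_of_list [i, k, j]"
    unfolding T\<^sub>3_def by blast
  have "s i \<noteq> i"
    using s ijk by (auto simp: transpose_def)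
  then have "s \<noteq> id"
    by auto
  moreover have "s \<in> carrier (alt_group n)"
    using \<open>s \<in> T\<^sub>3 n\<close> three_cycles_incl[of n] unfolding T\<^sub>3_eq_three_cycles by blast
  ultimately show "s \<in> carrier (alternating_group n) - {\<one>\<^bsub>alternating_group n\<^esub>}"
    by (simp add: alternating_group_def alt_group_one)
qed

lemma T\<^sub>3_inv_closed:
  assumes "s \<in> T\<^sub>3 n"
  shows "inv\<^bsub>alternating_group n\<^esub> s \<in> T\<^sub>3 n"
proof -
  obtain i j k where ijk: "1 \<le> i" "i < j" "j < k" "k \<le> n"
    and s: "s = cycle_of_list [i, j, k] \<or> s = cycle_of_list [i, k, j]"
    using assms unfolding T\<^sub>3_def by blast
  have "\<exists>t \<in> T\<^sub>3 n. s \<circ> t = id"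
  proof -
    have c: "cycle_of_list [i, j, k] \<circ> cycle_of_list [i, k, j] = id"
      "cycle_of_list [i, k, j] \<circ> cycle_of_list [i, j, k] = id"
      using ijk by (auto simp: fun_eq_iff transpose_def)
    have "cycle_of_list [i, j, k] \<in> T\<^sub>3 n" "cycle_of_list [i, k, j] \<in> T\<^sub>3 n"
      unfolding T\<^sub>3_def using ijk by blast+
    then show ?thesis
      using s c by blast
  qed
  then obtain t where t: "t \<in> T\<^sub>3 n" "s \<circ> t = id"
    by blast
  have "inv\<^bsub>alternating_group n\<^esub> s = t"
    using T\<^sub>3_subset[of n] assms t
    by (intro group.inv_equality[OF group_alternating_group])
       (auto simp: alternating_group_def alt_group_one)
  with t show ?thesis
    by simp
qed

end

theory Submission
  imports Defs
begin

text \<open>Write \<open>m = card S\<close>. The spectral gap of the 3-cycle graph on the even permutations of \<open>S\<close>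
  is bounded below by \<open>m * (m - 2)\<close>, by induction on \<open>m\<close> in terms of the Dirichlet form. Every
  3-cycle fixes \<open>m - 3\<close> points, so \<open>m - 3\<close> times the Dirichlet form is the sum over \<open>i\<close> of the
  Dirichlet forms on the cosets \<open>{g. g i = j}\<close> of the stabiliser of \<open>i\<close>, to which the induction
  hypothesis applies. The loss is the square sum of the coset averages; for a function of mean
  zero it is controlled by double transitivity, and the resulting factor
  \<open>m * (m - 2) / ((m - 1) * (m - 3))\<close> is exactly the ratio of consecutive gaps. The gap is
  attained by differences of the indicators of \<open>g a = j\<close>.\<close>

subsection \<open>Eigenvalues of matrices\<close>

text \<open>Conjugation by the matrix whose first column is the constant eigenvector and whose other
  columns are unit vectors splits off the eigenvalue \<open>d\<close>.\<close>

lemma char_poly_const_row_sum: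
  fixes A :: "'a :: field mat"
  assumes A: "A \<in> carrier_mat (Suc n) (Suc n)"
    and row: "\<And>i. i < Suc n \<Longrightarrow> (\<Sum>j<Suc n. A $$ (i, j)) = d"
  shows "char_poly A = [:- d, 1:] * char_poly (mat n n (\<lambda>(i, j). A $$ (Suc i, Suc j) - A $$ (0, Suc j)))"
proof -
  define A1 where "A1 = mat 1 1 (\<lambda>_. d)"
  define A2 where "A2 = mat 1 n (\<lambda>(i, j). A $$ (0, Suc j))"
  define A3 where "A3 = mat n n (\<lambda>(i, j). A $$ (Suc i, Suc j) - A $$ (0, Suc j))"
  define B where "B = four_block_mat A1 A2 (0\<^sub>m n 1) A3"
  define P where "P = mat (Suc n) (Suc n) (\<lambda>(i, j). if i = j \<or> j = 0 then 1 else 0 :: 'a)"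
  define P' where "P' = mat (Suc n) (Suc n) (\<lambda>(i, j). if i = j then 1 else if j = 0 then - 1 else 0 :: 'a)"
  have carr: "A1 \<in> carrier_mat 1 1" "A2 \<in> carrier_mat 1 n" "A3 \<in> carrier_mat n n"
    "P \<in> carrier_mat (Suc n) (Suc n)" "P' \<in> carrier_mat (Suc n) (Suc n)"
    by (simp_all add: A1_def A2_def A3_def P_def P'_def)
  have B: "B \<in> carrier_mat (Suc n) (Suc n)"
    using carr unfolding B_def by (metis four_block_carrier_mat plus_1_eq_Suc)
  have P_mult: "(P * M) $$ (i, j) = M $$ (i, j) + (if i = 0 then 0 else M $$ (0, j))"
    if M: "M \<in> carrier_mat (Suc n) (Suc n)" and ij: "i < Suc n" "j < Suc n" for M i j
  proof -
    have "(P * M) $$ (i, j) = (\<Sum>k<Suc n. P $$ (i, k) * M $$ (k, j))"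
      using ij carr M by (simp add: scalar_prod_def atLeast0LessThan)
    also have "\<dots> = (\<Sum>k<Suc n. (if k = i then M $$ (k, j) else 0) + (if k = 0 then if i = 0 then 0 else M $$ (k, j) else 0))"
      using ij by (intro sum.cong refl) (auto simp: P_def)
    also have "\<dots> = M $$ (i, j) + (if i = 0 then 0 else M $$ (0, j))"
      using ij by (simp only: sum.distrib sum.delta finite_lessThan lessThan_iff) simp
    finally show ?thesis .
  qed
  have inv: "P * P' = 1\<^sub>m (Suc n)"
  proof (rule eq_matI)
    fix i j assume "i < dim_row (1\<^sub>m (Suc n) :: 'a mat)" "j < dim_col (1\<^sub>m (Suc n) :: 'a mat)"
    then have "i < Suc n" "j < Suc n" by simp_all
    then show "(P * P') $$ (i, j) = 1\<^sub>m (Suc n) $$ (i, j)"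
      by (subst P_mult[OF carr(5)]) (auto simp: P'_def)
  qed (use carr in auto)
  have inv': "P' * P = 1\<^sub>m (Suc n)"
    using mat_mult_left_right_inverse[OF carr(4,5) inv] .
  \<comment> \<open>Both sides are \<open>A\<close> with column 0 replaced by \<open>d\<close>: on
    the left through the row sums, on the right because multiplying by \<open>P\<close> adds row 0
    back to the rows of \<open>A3\<close>.\<close>
  have AP: "A * P = P * B"
  proof (rule eq_matI)
    fix i j assume ij: "i < dim_row (P * B)" "j < dim_col (P * B)"
    then have ij: "i < Suc n" "j < Suc n" using carr B by auto
    have "(P * B) $$ (i, j) = B $$ (i, j) + (if i = 0 then 0 else B $$ (0, j))"
      by (rule P_mult[OF B ij])
    also have "\<dots> = (if j = 0 then d else A $$ (i, j))"
      using ij by (auto simp: B_def A1_def A2_def A3_def)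
    finally have 1: "(P * B) $$ (i, j) = (if j = 0 then d else A $$ (i, j))" .
    have "(A * P) $$ (i, j) = (\<Sum>k<Suc n. A $$ (i, k) * P $$ (k, j))"
      using ij carr A by (simp add: scalar_prod_def atLeast0LessThan)
    also have "\<dots> = (if j = 0 then d else A $$ (i, j))"
    proof (cases "j = 0")
      case True
      then show ?thesis using row[OF ij(1)] by (simp add: P_def)
    next
      case False
      then have "(\<Sum>k<Suc n. A $$ (i, k) * P $$ (k, j)) = (\<Sum>k<Suc n. if k = j then A $$ (i, k) else 0)"
        using ij by (intro sum.cong refl) (auto simp: P_def)
      also have "\<dots> = A $$ (i, j)"
        using ij by (simp only: sum.delta finite_lessThan lessThan_iff) simp
      finally show ?thesis using False by simp
    qed
    finally show "(A * P) $$ (i, j) = (P * B) $$ (i, j)" using 1 by simp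
  qed (use A B carr in auto)
  have "A = A * (P * P')" using A inv by simp
  also have "\<dots> = P * B * P'" using A carr AP by (metis assoc_mult_mat)
  finally have "similar_mat_wit A B P P'"
    by (rule similar_mat_witI[OF inv inv' _ A B carr(4,5)])
  then have "similar_mat A B"
    unfolding similar_mat_def by blast
  then have "char_poly A = char_poly A1 * char_poly A3"
    using char_poly_similar[of A B] char_poly_four_block_zeros_col[OF carr(1-3)] by (simp add: B_def)
  moreover have "char_poly A1 = [:- d, 1:]"
    by (simp add: A1_def char_poly_defs det_single)
  ultimately show ?thesis by (simp add: A3_def)
qed

text \<open>All of \<open>M\<close> apart from one \<open>l\<close> and the only \<open>d\<close> is
  at most \<open>l\<close>, so the sorted list ends in \<open>l, d\<close>. The multiplicity of
  \<open>l\<close> stays open; that of \<open>d\<close> must be one, or the second entry would be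
  \<open>d\<close> again.\<close>

lemma rev_sorted_list_of_multiset_top2:
  assumes "count M d = 1" "l \<in># M" "l < d" "\<And>x. x \<in># M \<Longrightarrow> x \<noteq> d \<Longrightarrow> x \<le> l"
  shows "rev (sorted_list_of_multiset M) ! 0 = d" "rev (sorted_list_of_multiset M) ! 1 = l"
proof -
  define M' where "M' = M - {#l, d#}"
  have "{#l, d#} \<subseteq># M"
    using assms(1-3) count_greater_zero_iff[of M l] by (auto simp: subseteq_mset_def not_less Suc_le_eq simp del: count_greater_zero_iff)
  then have M: "M = M' + {#l, d#}" unfolding M'_def by (rule subset_mset.diff_add[symmetric])
  then have "d \<notin># M'" using assms(1,3) by (simp add: not_in_iff split: if_splits)
  then have le: "x \<le> l" if "x \<in># M'" for x using that assms(4)[of x] M by (cases "x = d") auto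
  let ?xs = "sorted_list_of_multiset M' @ [l, d]"
  have "sorted ?xs" using le assms(3) by (fastforce simp: sorted_append)
  moreover have "M = mset ?xs" using M by simp
  ultimately have "sorted_list_of_multiset M = ?xs"
    by (metis sorted_list_of_multiset_mset sorted_sort_id)
  then show "rev (sorted_list_of_multiset M) ! 0 = d" "rev (sorted_list_of_multiset M) ! 1 = l"
    by simp_all
qed



subsection \<open>Even permutations and 3-cycles\<close>

text \<open>An arbitrary \<open>S\<close> in place of \<open>{1..n}\<close> lets the induction
  delete any point: \<open>even_perms (S - K)\<close> is the pointwise stabiliser of
  \<open>K\<close> in \<open>even_perms S\<close>.\<close>

definition even_perms :: "'a set \<Rightarrow> ('a \<Rightarrow> 'a) set" where
  "even_perms S = {p. p permutes S \<and> evenperm p}"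

definition cycles3 :: "'a set \<Rightarrow> ('a \<Rightarrow> 'a) set" where
  "cycles3 S = {cycle_of_list [a, b, c] | a b c. distinct [a, b, c] \<and> {a, b, c} \<subseteq> S}"

lemma finite_even_perms: "finite S \<Longrightarrow> finite (even_perms S)"
  by (simp add: even_perms_def finite_permutations)

lemma even_perms_comp:
  assumes "finite S" "p \<in> even_perms S" "q \<in> even_perms S"
  shows "p \<circ> q \<in> even_perms S"
  using assms unfolding even_perms_def
  by (auto simp: permutes_compose) (metis evenperm_comp permutation_permutes)

lemma even_perms_inv:
  assumes "finite S" "p \<in> even_perms S"
  shows "inv' p \<in> even_perms S"
  using assms unfolding even_perms_def
  by (auto simp: permutes_inv) (metis evenperm_inv permutation_permutes)

lemma even_perms_id: "id \<in> even_perms S"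
  by (simp add: even_perms_def permutes_id)

lemma even_perms_mono: "S \<subseteq> S' \<Longrightarrow> even_perms S \<subseteq> even_perms S'"
  by (auto simp: even_perms_def intro: permutes_subset)

lemma even_perms_in: "p \<in> even_perms S \<Longrightarrow> i \<in> S \<Longrightarrow> p i \<in> S"
  by (simp add: even_perms_def permutes_in_image)

lemma even_perms_inj: "p \<in> even_perms S \<Longrightarrow> p i = p j \<longleftrightarrow> i = j"
  using permutes_inj[of p S] by (auto simp: even_perms_def inj_def)

lemma even_perms_inv_iff: "p \<in> even_perms S \<Longrightarrow> p i = j \<longleftrightarrow> i = inv' p j"
  by (auto simp: even_perms_def permutes_inverses)

lemma three_cycle_apply:
  assumes "distinct [a, b, c]"
  shows "cycle_of_list [a, b, c] a = b" "cycle_of_list [a, b, c] b = c" "cycle_of_list [a, b, c] c = a"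
    and "x \<notin> {a, b, c} \<Longrightarrow> cycle_of_list [a, b, c] x = x"
  using assms by (auto simp: transpose_def)

lemma cycles3I: "distinct [a, b, c] \<Longrightarrow> {a, b, c} \<subseteq> S \<Longrightarrow> cycle_of_list [a, b, c] \<in> cycles3 S"
  unfolding cycles3_def by blast

lemma cycles3E:
  assumes "t \<in> cycles3 S"
  obtains a b c where "t = cycle_of_list [a, b, c]" "distinct [a, b, c]" "a \<in> S" "b \<in> S" "c \<in> S"
  using assms unfolding cycles3_def by blast

lemma cycles3_subset: "cycles3 S \<subseteq> even_perms S"
proof
  fix t assume "t \<in> cycles3 S"
  then obtain a b c where t: "t = cycle_of_list [a, b, c]" "distinct [a, b, c]" "a \<in> S" "b \<in> S" "c \<in> S"
    by (rule cycles3E)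
  have "t permutes S"
    unfolding t(1) using t by (intro permutes_subset[OF cycle_permutes]) auto
  moreover have "evenperm t"
    unfolding t(1) using t(2) by (simp add: evenperm_comp permutation_swap_id evenperm_swap permutation_compose)
  ultimately show "t \<in> even_perms S" by (simp add: even_perms_def)
qed

lemma id_notin_cycles3: "id \<notin> cycles3 S"
proof
  assume "id \<in> cycles3 S"
  then obtain a b c where t: "id = cycle_of_list [a, b, c]" "distinct [a, b, c]" "a \<in> S" "b \<in> S" "c \<in> S"
    by (rule cycles3E)
  show False using three_cycle_apply(1)[OF t(2)] t by (metis distinct_length_2_or_more id_apply)
qed

lemma finite_cycles3: "finite S \<Longrightarrow> finite (cycles3 S)"
  using cycles3_subset finite_even_perms finite_subset by blast

lemma cycles3_Diff: "cycles3 (S - {i}) = {t \<in> cycles3 S. t i = i}"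
proof (intro equalityI subsetI)
  fix t assume "t \<in> cycles3 (S - {i})"
  then obtain a b c where t: "t = cycle_of_list [a, b, c]" "distinct [a, b, c]" "a \<in> S - {i}" "b \<in> S - {i}" "c \<in> S - {i}"
    by (rule cycles3E)
  then show "t \<in> {t \<in> cycles3 S. t i = i}"
    using three_cycle_apply(4)[OF t(2), of i] cycles3I[OF t(2), of S] by auto
next
  fix t assume "t \<in> {t \<in> cycles3 S. t i = i}"
  then have "t \<in> cycles3 S" and i: "t i = i" by auto
  from this(1) obtain a b c where t: "t = cycle_of_list [a, b, c]" "distinct [a, b, c]" "a \<in> S" "b \<in> S" "c \<in> S"
    by (rule cycles3E)
  then have "i \<notin> {a, b, c}"
    using three_cycle_apply(1-3)[OF t(2)] i by (metis distinct_length_2_or_more insertE singletonD)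
  then show "t \<in> cycles3 (S - {i})"
    unfolding t(1) using t by (intro cycles3I) auto
qed

lemma card_fixed_cycles3:
  assumes "finite S" "t \<in> cycles3 S"
  shows "real (card {i \<in> S. t i = i}) = real (card S) - 3"
proof -
  from assms(2) obtain a b c where t: "t = cycle_of_list [a, b, c]" "distinct [a, b, c]" "a \<in> S" "b \<in> S" "c \<in> S"
    by (rule cycles3E)
  have "t i = i \<longleftrightarrow> i \<notin> {a, b, c}" for i
    unfolding t(1) using three_cycle_apply[OF t(2)] t(2) by (metis distinct_length_2_or_more insertE singletonD)
  then have "{i \<in> S. t i = i} = S - {a, b, c}" by auto
  moreover have "card {a, b, c} = 3" using t(2) by auto
  moreover have "{a, b, c} \<subseteq> S" using t by auto
  moreover have "card {a, b, c} \<le> card S" using t assms by (intro card_mono) auto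
  ultimately show ?thesis by (simp add: card_Diff_subset of_nat_diff)
qed

text \<open>Double counting of the pairs \<open>(i, t)\<close> with \<open>t i = i\<close>. It
  drives the inductions for the number of 3-cycles and for the gap.\<close>

lemma sum_cycles3_fixing:
  assumes "finite S"
  shows "(\<Sum>i\<in>S. \<Sum>t\<in>cycles3 (S - {i}). X t) = (real (card S) - 3) * (\<Sum>t\<in>cycles3 S. X t)"
proof -
  have "(\<Sum>i\<in>S. \<Sum>t\<in>cycles3 (S - {i}). X t) = (\<Sum>i\<in>S. \<Sum>t\<in>cycles3 S. if t i = i then X t else 0)"
    unfolding cycles3_Diff using finite_cycles3[OF assms] by (intro sum.cong refl sum.inter_filter)
  also have "\<dots> = (\<Sum>t\<in>cycles3 S. \<Sum>i\<in>S. if t i = i then X t else 0)"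
    by (rule sum.swap)
  also have "\<dots> = (\<Sum>t\<in>cycles3 S. (real (card S) - 3) * X t)"
    using assms by (intro sum.cong refl) (simp add: sum.If_cases card_fixed_cycles3 Int_def)
  finally show ?thesis by (simp add: sum_distrib_left)
qed

section \<open>Orders of stabilisers and sizes of their cosets\<close>

lemma card_even_perms:
  assumes "finite S" "card S \<ge> 2"
  shows "2 * card (even_perms S) = fact (card S)"
proof -
  obtain a b where ab: "a \<in> S" "b \<in> S" "a \<noteq> b"
    using assms by (metis card_2_iff' card_le_Suc_iff insertCI numeral_2_eq_2)
  define Od where "Od = {p. p permutes S \<and> \<not> evenperm p}"
  have perm: "permutation p" if "p permutes S" for p
    using that assms permutation_permutes by blast
  have "bij_betw (\<lambda>p. transpose a b \<circ> p) (even_perms S) Od"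
    by (rule bij_betw_byWitness[where f' = "\<lambda>p. transpose a b \<circ> p"])
      (use ab perm in \<open>auto simp: even_perms_def Od_def fun_eq_iff permutes_compose permutes_swap_id
         evenperm_comp permutation_swap_id evenperm_swap\<close>)
  then have "card Od = card (even_perms S)" by (simp add: bij_betw_same_card)
  moreover have "card (even_perms S \<union> Od) = card (even_perms S) + card Od"
    using assms by (intro card_Un_disjoint) (auto simp: even_perms_def Od_def finite_permutations)
  moreover have "even_perms S \<union> Od = {p. p permutes S}" by (auto simp: even_perms_def Od_def)
  ultimately show ?thesis using card_permutations[OF refl assms(1)] by simp
qed

lemma card_even_perms_pos: "finite S \<Longrightarrow> card (even_perms S) > 0"
  using even_perms_id finite_even_perms by (auto simp: card_gt_0_iff)

lemma real_card_even_perms: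
  assumes "finite S" "card S \<ge> 2"
  shows "real (card (even_perms S)) = fact (card S) / 2"
  using arg_cong[OF card_even_perms[OF assms], of real] by simp

lemma ex_outside:
  assumes "finite S" "card K < card S" "finite K"
  shows "\<exists>x\<in>S. x \<notin> K"
  using assms by (meson card_mono leD subsetI)

text \<open>At most two transpositions move \<open>i\<close> to \<open>j\<close> and
  \<open>k\<close> to \<open>l\<close>; if their product is odd, swapping two further points
  \<open>x\<close> and \<open>y\<close> repairs the parity without touching these values. The points
  \<open>j\<close>, \<open>l\<close>, \<open>x\<close>, \<open>y\<close> account for the bound on
  \<open>card S\<close>.\<close>

lemma even_perms_trans2:
  assumes "finite S" "card S \<ge> 4" "i \<in> S" "k \<in> S" "j \<in> S" "l \<in> S" "i \<noteq> k" "j \<noteq> l"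
  shows "\<exists>h\<in>even_perms S. h i = j \<and> h k = l"
proof -
  \<comment> \<open>\<open>transpose i j\<close> carries \<open>k\<close> to \<open>k'\<close>,
    which is not \<open>j\<close> because \<open>k\<close> is not \<open>i\<close>; hence sending
    \<open>k'\<close> to \<open>l\<close> afterwards keeps \<open>i\<close> at
    \<open>j\<close>.\<close>
  define k' where "k' = transpose i j k"
  define h where "h = transpose k' l \<circ> transpose i j"
  have k': "k' \<in> S" "k' \<noteq> j" using assms by (auto simp: k'_def transpose_def)
  have h: "h permutes S" "h i = j" "h k = l"
    using k' assms unfolding h_def
    by (auto intro!: permutes_compose permutes_swap_id simp: k'_def[symmetric]) 
  have perm: "permutation h" using h assms permutation_permutes by blast
  have "card {j, l} \<le> 2" by (simp add: card_insert_if)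
  then obtain x where x: "x \<in> S" "x \<notin> {j, l}"
    using ex_outside[OF assms(1), of "{j, l}"] assms by force
  have "card {j, l, x} \<le> 3" by (simp add: card_insert_if)
  then obtain y where y: "y \<in> S" "y \<notin> {j, l, x}"
    using ex_outside[OF assms(1), of "{j, l, x}"] assms by force
  define h' where "h' = (if evenperm h then h else transpose x y \<circ> h)"
  have "h' \<in> even_perms S"
    using h x y perm unfolding h'_def even_perms_def
    by (auto intro!: permutes_compose permutes_swap_id simp: evenperm_comp permutation_swap_id evenperm_swap)
  moreover have "h' i = j" "h' k = l" using h x y by (auto simp: h'_def transpose_def)
  ultimately show ?thesis by blast
qed

text \<open>These fibres are the left cosets of the pointwise stabiliser of \<open>K\<close>. The
  cases used are \<open>K\<close> empty, a point and a pair.\<close>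

lemma bij_betw_even_perms_coset:
  assumes "finite S" "h \<in> even_perms S" "K \<subseteq> S"
  shows "bij_betw (\<lambda>p. h \<circ> p) (even_perms (S - K)) {g \<in> even_perms S. \<forall>k\<in>K. g k = h k}"
proof (rule bij_betw_byWitness[where f' = "\<lambda>p. inv' h \<circ> p"])
  have h: "h permutes S" using assms by (simp add: even_perms_def)
  show "\<forall>p\<in>even_perms (S - K). inv' h \<circ> (h \<circ> p) = p"
    using permutes_inverses[OF h] by (auto simp: fun_eq_iff)
  show "\<forall>g\<in>{g \<in> even_perms S. \<forall>k\<in>K. g k = h k}. h \<circ> (inv' h \<circ> g) = g"
    using permutes_inverses[OF h] by (auto simp: fun_eq_iff)
  show "(\<lambda>p. h \<circ> p) ` even_perms (S - K) \<subseteq> {g \<in> even_perms S. \<forall>k\<in>K. g k = h k}"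
  proof safe
    fix p assume p: "p \<in> even_perms (S - K)"
    then show "h \<circ> p \<in> even_perms S"
      using even_perms_comp[OF assms(1,2)] even_perms_mono[of "S - K" S] by blast
    fix k assume "k \<in> K"
    then have "p k = k" using p by (auto simp: even_perms_def permutes_def)
    then show "(h \<circ> p) k = h k" by simp
  qed
  show "(\<lambda>g. inv' h \<circ> g) ` {g \<in> even_perms S. \<forall>k\<in>K. g k = h k} \<subseteq> even_perms (S - K)"
  proof safe
    fix g assume g: "g \<in> even_perms S" "\<forall>k\<in>K. g k = h k"
    have q: "inv' h \<circ> g \<in> even_perms S"
      using even_perms_comp[OF assms(1) even_perms_inv[OF assms(1,2)] g(1)] .
    have "(inv' h \<circ> g) permutes S - K"
      by (rule permutes_superset[of _ S])
        (use q g permutes_inverses[OF h] in \<open>auto simp: even_perms_def\<close>)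
    with q show "inv' h \<circ> g \<in> even_perms (S - K)" by (simp add: even_perms_def)
  qed
qed

lemma card_point_fibre2:
  assumes "finite S" "card S \<ge> 4" "i \<in> S" "k \<in> S" "j \<in> S" "l \<in> S" "i \<noteq> k" "j \<noteq> l"
  shows "real (card {g \<in> even_perms S. g i = j \<and> g k = l}) = fact (card S - 2) / 2"
proof -
  obtain h where h: "h \<in> even_perms S" "h i = j" "h k = l"
    using even_perms_trans2[OF assms] by blast
  have "{g \<in> even_perms S. \<forall>x\<in>{i, k}. g x = h x} = {g \<in> even_perms S. g i = j \<and> g k = l}"
    using h by auto
  then have "card {g \<in> even_perms S. g i = j \<and> g k = l} = card (even_perms (S - {i, k}))"
    using bij_betw_same_card[OF bij_betw_even_perms_coset[OF assms(1) h(1), of "{i, k}"]] assms by simp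
  moreover have "card (S - {i, k}) = card S - 2"
    using assms by (subst card_Diff_subset) auto
  ultimately show ?thesis using assms real_card_even_perms[of "S - {i, k}"] by simp
qed

lemma even_perms_trans1:
  assumes "finite S" "card S \<ge> 4" "i \<in> S" "j \<in> S"
  shows "\<exists>h\<in>even_perms S. h i = j"
proof -
  obtain k where "k \<in> S" "k \<notin> {i}" using ex_outside[OF assms(1), of "{i}"] assms by force
  moreover obtain l where "l \<in> S" "l \<notin> {j}" using ex_outside[OF assms(1), of "{j}"] assms by force
  ultimately show ?thesis using even_perms_trans2[OF assms(1-3), of k j l] assms(4) by auto
qed

lemma card_point_fibre:
  assumes "finite S" "card S \<ge> 4" "i \<in> S" "j \<in> S"
  shows "real (card {g \<in> even_perms S. g i = j}) = fact (card S - 1) / 2"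
proof -
  obtain h where h: "h \<in> even_perms S" "h i = j"
    using even_perms_trans1[OF assms] by blast
  have "card {g \<in> even_perms S. g i = j} = card (even_perms (S - {i}))"
    using bij_betw_same_card[OF bij_betw_even_perms_coset[OF assms(1) h(1), of "{i}"]] assms h by simp
  then show ?thesis using assms real_card_even_perms[of "S - {i}"] by simp
qed

lemma sum_fibres:
  fixes X :: "('a \<Rightarrow> 'a) \<Rightarrow> real"
  assumes "finite S" "i \<in> S"
  shows "(\<Sum>j\<in>S. \<Sum>g | g \<in> even_perms S \<and> g i = j. X g) = (\<Sum>g\<in>even_perms S. X g)"
  using assms by (intro sum.group) (auto simp: finite_even_perms even_perms_in)

subsection \<open>The spectral gap\<close>

text \<open>The bound comes from pairing \<open>f\<close> with \<open>\<phi> g = (\<Sum>i\<in>S. F i (g i))\<close>. Rows and columns of \<open>F\<close> sum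
  to zero and pairs of points are permuted uniformly, so both \<open>\<langle>f, \<phi>\<rangle>\<close> and \<open>\<langle>\<phi>, \<phi>\<rangle>\<close> are multiples
  of \<open>\<Sum>i j. (F i j)\<^sup>2\<close>.\<close>

lemma sum_sq_fibre_sums_le:
  assumes "finite S" "card S \<ge> 4" and f0: "(\<Sum>g\<in>even_perms S. f g) = 0"
  defines "F \<equiv> \<lambda>i j. \<Sum>g | g \<in> even_perms S \<and> g i = j. f g"
  shows "(real (card S) - 1) * (\<Sum>i\<in>S. \<Sum>j\<in>S. (F i j)\<^sup>2)
           \<le> real (card (even_perms S)) * (\<Sum>g\<in>even_perms S. (f g)\<^sup>2)"
proof -
  define m where "m = card S"
  define G where "G = even_perms S"
  define Q where "Q = (\<Sum>i\<in>S. \<Sum>j\<in>S. (F i j)\<^sup>2)"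
  define \<phi> where "\<phi> g = (\<Sum>i\<in>S. F i (g i))" for g
  define R where "R i k = (\<Sum>g\<in>G. F i (g i) * F k (g k))" for i k
  \<comment> \<open>\<open>c\<close> is the number of \<open>g\<close> with two prescribed values,
    and \<open>(real m - 1) * c\<close> the number with one.\<close>
  define c where "c = (fact (m - 2) / 2 :: real)"
  have m: "m \<ge> 4" using assms by (simp add: m_def)
  have fm1: "fact (m - 1) / 2 = (real m - 1) * c"
    using m fact_reduce[of "m - 1", where 'a = real] by (simp add: c_def numeral_2_eq_2 of_nat_diff)
  have fm: "real (card G) = real m * ((real m - 1) * c)"
    using m fact_reduce[of m, where 'a = real] real_card_even_perms[OF assms(1)] fm1
    by (simp add: G_def m_def)
  have c: "c > 0" by (simp add: c_def)
  have fin: "finite G" "finite S" using assms by (simp_all add: G_def finite_even_perms)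
  have row: "(\<Sum>j\<in>S. F i j) = 0" if "i \<in> S" for i
    unfolding F_def using sum_fibres[OF assms(1) that] f0 by simp
  \<comment> \<open>For a given \<open>j\<close> each \<open>g\<close> takes the value
    \<open>j\<close> at exactly one \<open>i\<close>, so this is again the sum of
    \<open>f\<close>.\<close>
  have col: "(\<Sum>i\<in>S. F i j) = 0" if "j \<in> S" for j
  proof -
    have "(\<Sum>i\<in>S. F i j) = (\<Sum>i\<in>S. \<Sum>g\<in>G. if g i = j then f g else 0)"
      unfolding F_def using fin unfolding G_def by (intro sum.cong refl sum.inter_filter)
    also have "\<dots> = (\<Sum>g\<in>G. \<Sum>i\<in>S. if g i = j then f g else 0)" by (rule sum.swap)
    also have "\<dots> = (\<Sum>g\<in>G. f g)"
    proof (intro sum.cong refl)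
      fix g assume g: "g \<in> G"
      then have "inv' g j \<in> S"
        using even_perms_in[OF even_perms_inv[OF assms(1)] that] by (simp add: G_def)
      moreover have "g i = j \<longleftrightarrow> i = inv' g j" for i using even_perms_inv_iff g by (simp add: G_def)
      ultimately show "(\<Sum>i\<in>S. if g i = j then f g else 0) = f g" using fin by (simp add: sum.delta)
    qed
    finally show ?thesis using f0 by (simp add: G_def)
  qed
  have fib: "(\<Sum>j\<in>S. \<Sum>g | g \<in> G \<and> g i = j. X g) = (\<Sum>g\<in>G. X g)" if "i \<in> S" for i and X :: "('a \<Rightarrow> 'a) \<Rightarrow> real"
    using sum_fibres[OF assms(1) that] by (simp add: G_def)
  have R_diag: "R i i = (real m - 1) * c * (\<Sum>j\<in>S. (F i j)\<^sup>2)" if "i \<in> S" for i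
  proof -
    have "R i i = (\<Sum>j\<in>S. \<Sum>g | g \<in> G \<and> g i = j. (F i (g i))\<^sup>2)"
      unfolding R_def fib[OF that] by (simp add: power2_eq_square)
    also have "\<dots> = (\<Sum>j\<in>S. (real m - 1) * c * (F i j)\<^sup>2)"
    proof (intro sum.cong refl)
      fix j assume "j \<in> S"
      then have "real (card {g \<in> G. g i = j}) = (real m - 1) * c"
        using card_point_fibre[OF assms(1,2) that] fm1 by (simp add: G_def m_def)
      then show "(\<Sum>g | g \<in> G \<and> g i = j. (F i (g i))\<^sup>2) = (real m - 1) * c * (F i j)\<^sup>2" by simp
    qed
    finally show ?thesis by (simp add: sum_distrib_left)
  qed
  \<comment> \<open>Once \<open>g i = j\<close> is given, \<open>g k\<close> is spread evenly over
    \<open>S - {j}\<close>. As row \<open>k\<close> of \<open>F\<close> sums to zero, only minus the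
    missing term \<open>l = j\<close> survives.\<close>
  have R_off: "R i k = - c * (\<Sum>j\<in>S. F i j * F k j)" if ik: "i \<in> S" "k \<in> S" "i \<noteq> k" for i k
  proof -
    have "R i k = (\<Sum>j\<in>S. \<Sum>g | g \<in> G \<and> g i = j. F i (g i) * F k (g k))"
      unfolding R_def fib[OF ik(1)] ..
    also have "\<dots> = (\<Sum>j\<in>S. - c * (F i j * F k j))"
    proof (intro sum.cong refl)
      fix j assume j: "j \<in> S"
      have "(\<Sum>g | g \<in> G \<and> g i = j. F i (g i) * F k (g k))
          = (\<Sum>l\<in>S. \<Sum>g | g \<in> {g \<in> G. g i = j} \<and> g k = l. F i (g i) * F k (g k))"
        by (rule sum.group[symmetric]) (use fin ik in \<open>auto simp: G_def even_perms_in\<close>)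
      also have "\<dots> = (\<Sum>l\<in>S. if l = j then 0 else c * (F i j * F k l))"
      proof (intro sum.cong refl)
        fix l assume l: "l \<in> S"
        show "(\<Sum>g | g \<in> {g \<in> G. g i = j} \<and> g k = l. F i (g i) * F k (g k))
            = (if l = j then 0 else c * (F i j * F k l))"
        proof (cases "l = j")
          case True
          then have "{g. g \<in> {g \<in> G. g i = j} \<and> g k = l} = {}"
            using ik by (auto simp: G_def) (metis even_perms_inj)
          then show ?thesis unfolding True by (simp only: sum.empty if_True refl)
        next
          case False
          then have "real (card {g \<in> G. g i = j \<and> g k = l}) = c"
            using card_point_fibre2[OF assms(1,2) ik(1,2) j l ik(3)] by (simp add: G_def m_def c_def)
          then show ?thesis using False by simp
        qed
      qed
      also have "\<dots> = (\<Sum>l\<in>S. c * F i j * F k l - (if l = j then c * (F i j * F k l) else 0))"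
        by (intro sum.cong) auto
      also have "\<dots> = c * F i j * (\<Sum>l\<in>S. F k l) - c * (F i j * F k j)"
        using fin j by (simp add: sum_subtractf sum_distrib_left)
      finally show "(\<Sum>g | g \<in> G \<and> g i = j. F i (g i) * F k (g k)) = - c * (F i j * F k j)"
        using row[OF ik(2)] by simp
    qed
    finally show ?thesis by (simp add: sum_distrib_left)
  qed
  have R_row: "(\<Sum>k\<in>S. R i k) = real m * c * (\<Sum>j\<in>S. (F i j)\<^sup>2)" if i: "i \<in> S" for i
  proof -
    \<comment> \<open>The diagonal coefficient \<open>(real m - 1) * c\<close> is split as
      \<open>real m * c - c\<close>, so that the off-diagonal formula runs over all \<open>k\<close>
      and vanishes by the column sums.\<close>
    have "(\<Sum>k\<in>S. R i k)
        = (\<Sum>k\<in>S. (if k = i then real m * c * (\<Sum>j\<in>S. (F i j)\<^sup>2) else 0) - c * (\<Sum>j\<in>S. F i j * F k j))"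
      using i by (intro sum.cong refl) (auto simp: R_diag R_off power2_eq_square algebra_simps)
    also have "\<dots> = real m * c * (\<Sum>j\<in>S. (F i j)\<^sup>2) - c * (\<Sum>k\<in>S. \<Sum>j\<in>S. F i j * F k j)"
      using i fin by (simp add: sum_subtractf sum_distrib_left)
    also have "(\<Sum>k\<in>S. \<Sum>j\<in>S. F i j * F k j) = (\<Sum>j\<in>S. F i j * (\<Sum>k\<in>S. F k j))"
      by (subst sum.swap) (simp add: sum_distrib_left)
    also have "\<dots> = 0" using col by simp
    finally show ?thesis by simp
  qed
  have norm: "(\<Sum>g\<in>G. (\<phi> g)\<^sup>2) = real m * c * Q"
  proof -
    have "(\<Sum>g\<in>G. (\<phi> g)\<^sup>2) = (\<Sum>g\<in>G. \<Sum>i\<in>S. \<Sum>k\<in>S. F i (g i) * F k (g k))"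
      by (simp add: \<phi>_def power2_eq_square sum_product)
    also have "\<dots> = (\<Sum>i\<in>S. \<Sum>g\<in>G. \<Sum>k\<in>S. F i (g i) * F k (g k))" by (rule sum.swap)
    also have "\<dots> = (\<Sum>i\<in>S. \<Sum>k\<in>S. R i k)"
      unfolding R_def by (intro sum.cong refl sum.swap)
    finally show ?thesis using R_row by (simp add: Q_def sum_distrib_left)
  qed
  have inner: "(\<Sum>g\<in>G. f g * \<phi> g) = Q"
  proof -
    have "(\<Sum>g\<in>G. f g * \<phi> g) = (\<Sum>i\<in>S. \<Sum>g\<in>G. f g * F i (g i))"
      unfolding \<phi>_def sum_distrib_left by (rule sum.swap)
    also have "\<dots> = (\<Sum>i\<in>S. \<Sum>j\<in>S. (F i j)\<^sup>2)"
    proof (intro sum.cong refl)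
      fix i assume i: "i \<in> S"
      have "(\<Sum>g\<in>G. f g * F i (g i)) = (\<Sum>j\<in>S. \<Sum>g | g \<in> G \<and> g i = j. f g * F i (g i))"
        by (rule fib[OF i, symmetric])
      also have "\<dots> = (\<Sum>j\<in>S. (\<Sum>g | g \<in> G \<and> g i = j. f g) * F i j)"
        by (simp add: sum_distrib_right)
      finally show "(\<Sum>g\<in>G. f g * F i (g i)) = (\<Sum>j\<in>S. (F i j)\<^sup>2)"
        by (simp add: F_def G_def power2_eq_square)
    qed
    finally show ?thesis by (simp add: Q_def)
  qed
  \<comment> \<open>By \<open>inner\<close> and \<open>norm\<close>, \<open>\<phi>\<close> divided
    by \<open>real m * c\<close> is the orthogonal projection of \<open>f\<close> to the line of
    \<open>\<phi>\<close>; the remainder, scaled by \<open>real m * c\<close>, is squared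
    here.\<close>
  have "0 \<le> (\<Sum>g\<in>G. (real m * c * f g - \<phi> g)\<^sup>2)" by (intro sum_nonneg) simp
  also have "\<dots> = (\<Sum>g\<in>G. (real m * c)\<^sup>2 * (f g)\<^sup>2 - 2 * (real m * c) * (f g * \<phi> g) + (\<phi> g)\<^sup>2)"
    by (intro sum.cong refl) (simp add: power2_eq_square algebra_simps)
  also have "\<dots> = (real m * c)\<^sup>2 * (\<Sum>g\<in>G. (f g)\<^sup>2) - 2 * (real m * c) * Q + real m * c * Q"
    by (simp add: sum.distrib sum_subtractf sum_distrib_left[symmetric] inner norm)
  also have "\<dots> = real m * c * (real m * c * (\<Sum>g\<in>G. (f g)\<^sup>2) - Q)"
    by (simp add: power2_eq_square algebra_simps)
  finally have "Q \<le> real m * c * (\<Sum>g\<in>G. (f g)\<^sup>2)"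
    using m c mult_pos_pos[of "real m" c] by (simp add: zero_le_mult_iff not_le[symmetric])
  then have "(real m - 1) * Q \<le> (real m - 1) * (real m * c * (\<Sum>g\<in>G. (f g)\<^sup>2))"
    using m by (intro mult_left_mono) auto
  also have "\<dots> = real (card G) * (\<Sum>g\<in>G. (f g)\<^sup>2)" by (simp add: fm)
  finally show ?thesis by (simp add: m_def Q_def G_def)
qed

text \<open>Edges are counted from both ends, once with \<open>t\<close> and once with its inverse;
  this is the factor 2 in the later bounds. Neighbours are \<open>g \<circ> t\<close>, so the form
  is invariant under composition from the left.\<close>

definition dirichlet :: "'a set \<Rightarrow> (('a \<Rightarrow> 'a) \<Rightarrow> real) \<Rightarrow> real" where
  "dirichlet S f = (\<Sum>g\<in>even_perms S. \<Sum>t\<in>cycles3 S. (f g - f (g \<circ> t))\<^sup>2)"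

text \<open>Base case of both inductions: on three points the even permutations form a group of
  order 3, whose two non-identity elements are the two 3-cycles.\<close>

lemma card3_cycles3:
  assumes "finite S" "card S = 3"
  shows "cycles3 S = even_perms S - {id}" "card (cycles3 S) = 2"
proof -
  have E: "card (even_perms S) = 3"
    using card_even_perms[OF assms(1)] assms(2) by (simp add: fact_numeral)
  then have E': "card (even_perms S - {id}) = 2"
    using even_perms_id[of S] assms finite_even_perms by simp
  obtain a b c where abc: "S = {a, b, c}" "a \<noteq> b" "b \<noteq> c" "a \<noteq> c"
    using assms(2) by (metis card_3_iff)
  have "cycle_of_list [a, b, c] \<noteq> cycle_of_list [a, c, b]"
    using three_cycle_apply(1)[of a b c] three_cycle_apply(1)[of a c b] abc(2-4)
    by (metis distinct_length_2_or_more distinct_singleton)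
  then have "card {cycle_of_list [a, b, c], cycle_of_list [a, c, b]} = 2"
    by (rule card_2_iff[THEN iffD2, OF exI, OF exI, OF conjI, OF refl])
  moreover have "{cycle_of_list [a, b, c], cycle_of_list [a, c, b]} \<subseteq> cycles3 S"
    using cycles3I[of a b c S] cycles3I[of a c b S] abc by auto
  ultimately have "2 \<le> card (cycles3 S)"
    using card_mono[OF finite_cycles3[OF assms(1)]] by (metis (no_types))
  moreover have sub: "cycles3 S \<subseteq> even_perms S - {id}"
    using cycles3_subset id_notin_cycles3 by blast
  ultimately show "cycles3 S = even_perms S - {id}"
    using E' card_seteq[OF _ sub] assms finite_even_perms by auto
  with E' show "card (cycles3 S) = 2" by simp
qed

text \<open>Induction through double counting of fixed points. Starting at three points keeps the
  factor \<open>card S - 3\<close> nonzero in the step, where it is cancelled.\<close>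

lemma card_cycles3_ge3:
  assumes "finite S" "card S \<ge> 3"
  shows "real (card (cycles3 S)) = real (card S) * (real (card S) - 1) * (real (card S) - 2) / 3"
  using assms(2,1)
proof (induction "card S" arbitrary: S rule: nat_induct_at_least)
  case base
  then show ?case using card3_cycles3[of S] by simp
next
  case (Suc m)
  have "(real (card S) - 3) * real (card (cycles3 S)) = (\<Sum>i\<in>S. real (card (cycles3 (S - {i}))))"
    using sum_cycles3_fixing[OF Suc.prems(1), of "\<lambda>_. 1"] by simp
  also have "\<dots> = (\<Sum>i\<in>S. real m * (real m - 1) * (real m - 2) / 3)"
  proof (intro sum.cong refl)
    fix i assume "i \<in> S"
    then have "card (S - {i}) = m" using Suc.hyps(3)[symmetric] Suc.prems by simp
    then show "real (card (cycles3 (S - {i}))) = real m * (real m - 1) * (real m - 2) / 3"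
      using Suc.hyps(2)[of "S - {i}"] Suc.prems by simp
  qed
  also have "\<dots> = (real m - 2) * ((real m + 1) * real m * (real m - 1) / 3)"
    using Suc(3)[symmetric] by simp
  finally show ?case using Suc(1) Suc(3)[symmetric] by simp
qed

lemma sum_sq_diff:
  fixes f :: "'b \<Rightarrow> real"
  shows "(\<Sum>x\<in>A. \<Sum>y\<in>A. (f x - f y)\<^sup>2) = 2 * real (card A) * (\<Sum>x\<in>A. (f x)\<^sup>2) - 2 * (\<Sum>x\<in>A. f x)\<^sup>2"
proof -
  have "(\<Sum>x\<in>A. \<Sum>y\<in>A. (f x - f y)\<^sup>2) = (\<Sum>x\<in>A. \<Sum>y\<in>A. (f x)\<^sup>2 + (f y)\<^sup>2 - 2 * (f x * f y))"
    by (simp add: power2_eq_square algebra_simps)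
  also have "\<dots> = 2 * real (card A) * (\<Sum>x\<in>A. (f x)\<^sup>2) - 2 * (\<Sum>x\<in>A. \<Sum>y\<in>A. f x * f y)"
    by (simp add: sum.distrib sum_subtractf sum_distrib_left[symmetric])
  finally show ?thesis by (simp add: power2_eq_square sum_product)
qed

lemma bij_betw_even_perms_left:
  assumes "finite S" "h \<in> even_perms S"
  shows "bij_betw (\<lambda>p. h \<circ> p) (even_perms S) (even_perms S)"
  using bij_betw_even_perms_coset[OF assms, of "{}"] by simp

lemma dirichlet_ge:
  assumes "finite S" "card S \<ge> 3"
  shows "dirichlet S f \<ge> 2 * real (card S) * (real (card S) - 2) *
           ((\<Sum>g\<in>even_perms S. (f g)\<^sup>2) - (\<Sum>g\<in>even_perms S. f g)\<^sup>2 / real (card (even_perms S)))"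
  using assms(2,1)
proof (induction "card S" arbitrary: S f rule: nat_induct_at_least)
  case base
  let ?E = "even_perms S"
  have E: "card ?E = 3"
    using card_even_perms[of S] base by (simp add: fact_numeral)
  \<comment> \<open>On three points the graph is complete: \<open>g \<circ> t\<close> runs through
    all of \<open>?E\<close> once the vanishing term \<open>t = id\<close> is added. The bound is
    then an equality.\<close>
  have "dirichlet S f = (\<Sum>g\<in>?E. \<Sum>h\<in>?E. (f g - f h)\<^sup>2)"
    unfolding dirichlet_def
  proof (rule sum.cong[OF refl])
    fix g assume g: "g \<in> ?E"
    have "(\<Sum>t\<in>cycles3 S. (f g - f (g \<circ> t))\<^sup>2) = (\<Sum>t\<in>?E. (f g - f (g \<circ> t))\<^sup>2)"
      unfolding card3_cycles3(1)[OF base(2) base(1)[symmetric]]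
      by (rule sum.mono_neutral_left) (auto simp: finite_even_perms[OF base(2)])
    also have "\<dots> = (\<Sum>h\<in>?E. (f g - f h)\<^sup>2)"
      by (rule sum.reindex_bij_betw[OF bij_betw_even_perms_left[OF base(2) g]])
    finally show "(\<Sum>t\<in>cycles3 S. (f g - f (g \<circ> t))\<^sup>2) = (\<Sum>h\<in>?E. (f g - f h)\<^sup>2)" .
  qed
  then show ?case using E base(1)[symmetric] by (simp add: sum_sq_diff)
next
  case (Suc m)
  let ?E = "even_perms S"
  define N where "N = real (card ?E)"
  have S: "finite S" "card S = Suc m" "m \<ge> 3" using Suc.hyps(1,3) Suc.prems by simp_all
  have N: "N > 0" using card_even_perms_pos[OF S(1)] by (simp add: N_def)
  have mean0: "dirichlet S f \<ge> 2 * real (card S) * (real (card S) - 2) * (\<Sum>g\<in>?E. (f g)\<^sup>2)"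
    if f0: "(\<Sum>g\<in>?E. f g) = 0" for f
  proof -
    define F where "F i j = (\<Sum>g | g \<in> ?E \<and> g i = j. f g)" for i j
    \<comment> \<open>\<open>M\<close> is the size of every coset \<open>{g. g i = j}\<close>, and
      \<open>c\<close> below is the constant of the induction hypothesis for \<open>m\<close>
      points.\<close>
    define M where "M = (fact m / 2 :: real)"
    have M: "M > 0" "N = (real m + 1) * M"
      using real_card_even_perms[OF S(1)] S by (simp_all add: M_def N_def)
    define c where "c = 2 * real m * (real m - 2)"
    have c: "c > 0" using S by (simp add: c_def)
    have coset: "(\<Sum>g | g \<in> ?E \<and> g i = j. \<Sum>t\<in>cycles3 (S - {i}). (f g - f (g \<circ> t))\<^sup>2)
        \<ge> c * ((\<Sum>g | g \<in> ?E \<and> g i = j. (f g)\<^sup>2) - (F i j)\<^sup>2 / M)" if ij: "i \<in> S" "j \<in> S" for i j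
    proof -
      obtain h where h: "h \<in> ?E" "h i = j" using even_perms_trans1[OF S(1) _ ij] S by auto
      have bij: "bij_betw (\<lambda>p. h \<circ> p) (even_perms (S - {i})) {g \<in> ?E. g i = j}"
        using bij_betw_even_perms_coset[OF S(1) h(1), of "{i}"] h ij by simp
      have cS: "card (S - {i}) = m" using S ij by simp
      have cE: "real (card (even_perms (S - {i}))) = M"
        using real_card_even_perms[of "S - {i}"] cS S by (simp add: M_def)
      \<comment> \<open>Composition with \<open>h\<close> from the left commutes with composition
        with \<open>t\<close> from the right, so the induction hypothesis applies to
        \<open>f\<close> translated by \<open>h\<close>.\<close>
      have "c * ((\<Sum>p\<in>even_perms (S - {i}). (f (h \<circ> p))\<^sup>2) - (\<Sum>p\<in>even_perms (S - {i}). f (h \<circ> p))\<^sup>2 / M)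
          \<le> dirichlet (S - {i}) (\<lambda>p. f (h \<circ> p))"
        using Suc.hyps(2)[of "S - {i}" "\<lambda>p. f (h \<circ> p)"] cS cE S by (simp add: c_def)
      also have "\<dots> = (\<Sum>p\<in>even_perms (S - {i}). \<Sum>t\<in>cycles3 (S - {i}). (f (h \<circ> p) - f ((h \<circ> p) \<circ> t))\<^sup>2)"
        by (simp add: dirichlet_def comp_assoc)
      also have "\<dots> = (\<Sum>g | g \<in> ?E \<and> g i = j. \<Sum>t\<in>cycles3 (S - {i}). (f g - f (g \<circ> t))\<^sup>2)"
        by (rule sum.reindex_bij_betw[OF bij])
      also have "(\<Sum>p\<in>even_perms (S - {i}). (f (h \<circ> p))\<^sup>2) = (\<Sum>g | g \<in> ?E \<and> g i = j. (f g)\<^sup>2)"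
        by (rule sum.reindex_bij_betw[OF bij])
      also have "(\<Sum>p\<in>even_perms (S - {i}). f (h \<circ> p)) = F i j"
        unfolding F_def by (rule sum.reindex_bij_betw[OF bij])
      finally show ?thesis .
    qed
    \<comment> \<open>Summation over \<open>j\<close> reassembles \<open>?E\<close> for each
      \<open>i\<close>; summation over \<open>i\<close> then meets every 3-cycle once for each of
      its \<open>m - 2\<close> fixed points.\<close>
    have "(\<Sum>i\<in>S. \<Sum>j\<in>S. c * ((\<Sum>g | g \<in> ?E \<and> g i = j. (f g)\<^sup>2) - (F i j)\<^sup>2 / M))
        \<le> (\<Sum>i\<in>S. \<Sum>j\<in>S. \<Sum>g | g \<in> ?E \<and> g i = j. \<Sum>t\<in>cycles3 (S - {i}). (f g - f (g \<circ> t))\<^sup>2)"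
      by (intro sum_mono coset)
    also have "\<dots> = (\<Sum>i\<in>S. \<Sum>g\<in>?E. \<Sum>t\<in>cycles3 (S - {i}). (f g - f (g \<circ> t))\<^sup>2)"
      using sum_fibres[OF S(1)] by simp
    also have "\<dots> = (\<Sum>g\<in>?E. \<Sum>i\<in>S. \<Sum>t\<in>cycles3 (S - {i}). (f g - f (g \<circ> t))\<^sup>2)"
      by (rule sum.swap)
    also have "\<dots> = (real m - 2) * dirichlet S f"
      using S by (simp add: sum_cycles3_fixing dirichlet_def sum_distrib_left)
    finally have 1: "(\<Sum>i\<in>S. \<Sum>j\<in>S. c * ((\<Sum>g | g \<in> ?E \<and> g i = j. (f g)\<^sup>2) - (F i j)\<^sup>2 / M))
        \<le> (real m - 2) * dirichlet S f" .
    define V where "V = (\<Sum>g\<in>?E. (f g)\<^sup>2)"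
    define Q where "Q = (\<Sum>i\<in>S. \<Sum>j\<in>S. (F i j)\<^sup>2)"
    have "(\<Sum>i\<in>S. \<Sum>j\<in>S. c * ((\<Sum>g | g \<in> ?E \<and> g i = j. (f g)\<^sup>2) - (F i j)\<^sup>2 / M))
        = c * ((\<Sum>i\<in>S. \<Sum>j\<in>S. \<Sum>g | g \<in> ?E \<and> g i = j. (f g)\<^sup>2) - Q / M)"
      by (simp add: sum_distrib_left sum_subtractf right_diff_distrib sum_divide_distrib Q_def)
    also have "(\<Sum>i\<in>S. \<Sum>j\<in>S. \<Sum>g | g \<in> ?E \<and> g i = j. (f g)\<^sup>2) = (real m + 1) * V"
      using sum_fibres[OF S(1)] S by (simp add: V_def)
    finally have 2: "c * ((real m + 1) * V - Q / M) \<le> (real m - 2) * dirichlet S f"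
      using 1 by simp
    have "real m * Q \<le> N * V"
      using sum_sq_fibre_sums_le[OF S(1) _ f0] S by (simp add: V_def Q_def F_def N_def)
    \<comment> \<open>As \<open>N = (real m + 1) * M\<close>, the loss is at most the fraction
      \<open>1 / m\<close> of the main term.\<close>
    then have "Q / M \<le> (real m + 1) * V / real m"
      using M S by (simp add: field_simps)
    then have "c * ((real m + 1) * V - (real m + 1) * V / real m) \<le> (real m - 2) * dirichlet S f"
      using 2 mult_left_mono[of "(real m + 1) * V - (real m + 1) * V / real m" "(real m + 1) * V - Q / M" c] c
      by linarith
    \<comment> \<open>The factor \<open>1 - 1 / m\<close> cancels the \<open>m\<close> in
      \<open>c\<close> and leaves \<open>m - 2\<close> times \<open>2 * (m + 1) * (m - 1)\<close>,
      the constant for \<open>m + 1\<close> points; the positive factor \<open>m - 2\<close> is then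
      cancelled.\<close>
    moreover have "c * ((real m + 1) * V - (real m + 1) * V / real m)
        = (real m - 2) * (2 * (real m + 1) * (real m - 1) * V)"
      using S by (simp add: c_def field_simps)
    ultimately have "(real m - 2) * (2 * (real m + 1) * (real m - 1) * V) \<le> (real m - 2) * dirichlet S f"
      by simp
    then have "2 * (real m + 1) * (real m - 1) * V \<le> dirichlet S f"
      by (rule mult_left_le_imp_le) (use S in simp)
    then show ?thesis using S by (simp add: V_def add.commute)
  qed
  define \<mu> where "\<mu> = (\<Sum>g\<in>?E. f g) / N"
  have mu: "(\<Sum>g\<in>?E. f g) = N * \<mu>" using N by (simp add: \<mu>_def)
  have "(\<Sum>g\<in>?E. f g - \<mu>) = 0" by (simp add: sum_subtractf mu N_def)
  from mean0[OF this]
  have "dirichlet S f \<ge> 2 * real (card S) * (real (card S) - 2) * (\<Sum>g\<in>?E. (f g - \<mu>)\<^sup>2)"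
    by (simp add: dirichlet_def)
  also have "(\<Sum>g\<in>?E. (f g - \<mu>)\<^sup>2) = (\<Sum>g\<in>?E. (f g)\<^sup>2 - 2 * \<mu> * f g + \<mu>\<^sup>2)"
    by (simp add: power2_eq_square algebra_simps)
  also have "\<dots> = (\<Sum>g\<in>?E. (f g)\<^sup>2) - 2 * \<mu> * (N * \<mu>) + N * \<mu>\<^sup>2"
    by (simp add: sum.distrib sum_subtractf sum_distrib_left[symmetric] mu N_def)
  also have "\<dots> = (\<Sum>g\<in>?E. (f g)\<^sup>2) - (\<Sum>g\<in>?E. f g)\<^sup>2 / N"
    using N by (simp add: mu power2_eq_square)
  finally show ?case by (simp add: N_def)
qed

section \<open>The adjacency operator and its eigenfunctions\<close>

lemma bij_betw_even_perms_right:
  assumes "finite S" "t \<in> even_perms S"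
  shows "bij_betw (\<lambda>g. g \<circ> t) (even_perms S) (even_perms S)"
proof (rule bij_betw_byWitness[where f' = "\<lambda>g. g \<circ> inv' t"])
  have t: "t permutes S" using assms(2) by (simp add: even_perms_def)
  show "\<forall>g\<in>even_perms S. g \<circ> t \<circ> inv' t = g" "\<forall>g\<in>even_perms S. g \<circ> inv' t \<circ> t = g"
    using permutes_inverses[OF t] by (auto simp: fun_eq_iff)
qed (use assms in \<open>auto intro: even_perms_comp even_perms_inv\<close>)

text \<open>The adjacency operator of the graph, acting on functions of permutations; this keeps
  enumerations of the vertices out of the argument.\<close>

definition nbr_sum :: "'a set \<Rightarrow> (('a \<Rightarrow> 'a) \<Rightarrow> real) \<Rightarrow> ('a \<Rightarrow> 'a) \<Rightarrow> real" where
  "nbr_sum S f g = (\<Sum>t\<in>cycles3 S. f (g \<circ> t))"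

text \<open>Composition with each \<open>t\<close> from the right permutes
  \<open>even_perms S\<close>. Consequently an eigenfunction for an eigenvalue other than the degree
  sums to zero.\<close>

lemma sum_nbr_sum:
  assumes "finite S"
  shows "(\<Sum>g\<in>even_perms S. nbr_sum S f g) = real (card (cycles3 S)) * (\<Sum>g\<in>even_perms S. f g)"
proof -
  have "(\<Sum>g\<in>even_perms S. nbr_sum S f g) = (\<Sum>t\<in>cycles3 S. \<Sum>g\<in>even_perms S. f (g \<circ> t))"
    unfolding nbr_sum_def by (rule sum.swap)
  also have "\<dots> = (\<Sum>t\<in>cycles3 S. \<Sum>g\<in>even_perms S. f g)"
    by (intro sum.cong[OF refl] sum.reindex_bij_betw bij_betw_even_perms_right assms)
      (use cycles3_subset in blast)
  finally show ?thesis by simp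
qed

text \<open>After expanding, the squares at \<open>g\<close> and at \<open>g \<circ> t\<close> have
  equal sums. The form is thus twice the quadratic form of the Laplacian, degree minus
  adjacency.\<close>

lemma dirichlet_eq:
  assumes "finite S"
  shows "dirichlet S f = 2 * real (card (cycles3 S)) * (\<Sum>g\<in>even_perms S. (f g)\<^sup>2)
           - 2 * (\<Sum>g\<in>even_perms S. f g * nbr_sum S f g)"
proof -
  have "dirichlet S f = (\<Sum>g\<in>even_perms S. \<Sum>t\<in>cycles3 S. (f g)\<^sup>2 + (f (g \<circ> t))\<^sup>2 - 2 * (f g * f (g \<circ> t)))"
    unfolding dirichlet_def by (simp add: power2_eq_square algebra_simps)
  also have "\<dots> = (\<Sum>g\<in>even_perms S. real (card (cycles3 S)) * (f g)\<^sup>2 + nbr_sum S (\<lambda>g. (f g)\<^sup>2) g - 2 * (f g * nbr_sum S f g))"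
    by (simp add: nbr_sum_def sum.distrib sum_subtractf sum_distrib_left[symmetric])
  also have "\<dots> = 2 * real (card (cycles3 S)) * (\<Sum>g\<in>even_perms S. (f g)\<^sup>2)
           - 2 * (\<Sum>g\<in>even_perms S. f g * nbr_sum S f g)"
    by (simp add: sum.distrib sum_subtractf sum_distrib_left[symmetric] sum_nbr_sum[OF assms])
  finally show ?thesis .
qed

lemma eigenvalue_le_of_sum_zero:
  assumes S: "finite S" "card S \<ge> 3"
    and eig: "\<And>g. g \<in> even_perms S \<Longrightarrow> nbr_sum S f g = x * f g + c"
    and f0: "(\<Sum>g\<in>even_perms S. f g) = 0"
    and nz: "h \<in> even_perms S" "f h \<noteq> 0"
  shows "x \<le> real (card (cycles3 S)) - real (card S) * (real (card S) - 2)"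
proof -
  define V where "V = (\<Sum>g\<in>even_perms S. (f g)\<^sup>2)"
  have V: "V > 0"
    unfolding V_def by (rule sum_pos2[OF finite_even_perms[OF S(1)] nz(1)]) (use nz in auto)
  have "(\<Sum>g\<in>even_perms S. f g * nbr_sum S f g) = (\<Sum>g\<in>even_perms S. x * (f g)\<^sup>2 + c * f g)"
    by (intro sum.cong refl) (simp add: eig power2_eq_square algebra_simps)
  also have "\<dots> = x * V"
    by (simp add: sum.distrib sum_distrib_left[symmetric] f0 V_def)
  finally have "dirichlet S f = 2 * real (card (cycles3 S)) * V - 2 * (x * V)"
    by (simp add: dirichlet_eq[OF S(1)] V_def)
  then have "2 * real (card S) * (real (card S) - 2) * V \<le> 2 * real (card (cycles3 S)) * V - 2 * (x * V)"
    using dirichlet_ge[OF S, of f] f0 by (simp add: V_def)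
  then have "V * x \<le> V * (real (card (cycles3 S)) - real (card S) * (real (card S) - 2))"
    by (simp add: algebra_simps)
  then show ?thesis using V by simp
qed

text \<open>Subtracting the mean preserves the equation, because constants have eigenvalue
  \<open>card (cycles3 S)\<close>. A nonzero remainder would contradict the strict gap.\<close>

lemma top_eigenfunction_const:
  assumes S: "finite S" "card S \<ge> 3"
    and eig: "\<And>g. g \<in> even_perms S \<Longrightarrow> nbr_sum S f g = real (card (cycles3 S)) * f g + c"
    and gh: "g \<in> even_perms S" "h \<in> even_perms S"
  shows "f g = f h"
proof -
  define N where "N = real (card (even_perms S))"
  define \<mu> where "\<mu> = (\<Sum>g\<in>even_perms S. f g) / N"
  have N: "N > 0" using card_even_perms_pos[OF S(1)] by (simp add: N_def)
  have sum0: "(\<Sum>g\<in>even_perms S. f g - \<mu>) = 0"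
    using N by (simp add: sum_subtractf \<mu>_def N_def[symmetric])
  have eig': "nbr_sum S (\<lambda>g. f g - \<mu>) g = real (card (cycles3 S)) * (f g - \<mu>) + c"
    if "g \<in> even_perms S" for g
    using eig[OF that] by (simp add: nbr_sum_def sum_subtractf algebra_simps)
  have "f g - \<mu> = 0" if g: "g \<in> even_perms S" for g
  proof (rule ccontr)
    assume "f g - \<mu> \<noteq> 0"
    from eigenvalue_le_of_sum_zero[of S "\<lambda>g. f g - \<mu>", OF S eig' sum0 g this]
    have "real (card S) * (real (card S) - 2) \<le> 0" by simp
    moreover have "real (card S) * (real (card S) - 2) > 0" using S by simp
    ultimately show False by simp
  qed
  from this[OF gh(1)] this[OF gh(2)] show ?thesis by simp
qed

section \<open>Functions attaining the gap\<close>

lemma three_cycle_rotate: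
  assumes "distinct [a, b, c]"
  shows "cycle_of_list [a, b, c] = cycle_of_list [b, c, a]"
  using assms by (auto simp: fun_eq_iff transpose_def)

text \<open>Up to rotation the cycle starts with \<open>a\<close>, followed by \<open>k\<close>;
  only the third point is free.\<close>

lemma cycles3_move:
  assumes "a \<in> S" "k \<in> S" "a \<noteq> k"
  shows "{t \<in> cycles3 S. t a = k} = (\<lambda>c. cycle_of_list [a, k, c]) ` (S - {a, k})"
proof (intro equalityI subsetI)
  fix t assume "t \<in> {t \<in> cycles3 S. t a = k}"
  then have "t \<in> cycles3 S" and ta: "t a = k" by auto
  from this(1) obtain x y z where t: "t = cycle_of_list [x, y, z]" "distinct [x, y, z]" "x \<in> S" "y \<in> S" "z \<in> S"
    by (rule cycles3E)
  have "\<exists>c \<in> S - {a, k}. t = cycle_of_list [a, k, c]"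
  proof -
    have ap: "t x = y" "t y = z" "t z = x" unfolding t(1) using three_cycle_apply[OF t(2)] by blast+
    have "a \<in> {x, y, z}"
      using three_cycle_apply(4)[OF t(2), of a] ta assms(3) unfolding t(1) by metis
    then consider "a = x" | "a = y" | "a = z" by blast
    then show ?thesis
    proof cases
      case 1
      then show ?thesis using t ap ta by (intro bexI[of _ z]) auto
    next
      case 2
      have "t = cycle_of_list [y, z, x]" unfolding t(1) by (rule three_cycle_rotate[OF t(2)])
      then show ?thesis using 2 t(2-) ap ta by (intro bexI[of _ x]) auto
    next
      case 3
      have "cycle_of_list [z, x, y] = t" unfolding t(1) by (rule three_cycle_rotate) (use t in auto)
      then show ?thesis using 3 t(2-) ap ta by (intro bexI[of _ y]) auto
    qed
  qed
  then show "t \<in> (\<lambda>c. cycle_of_list [a, k, c]) ` (S - {a, k})" by blast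
next
  fix t assume "t \<in> (\<lambda>c. cycle_of_list [a, k, c]) ` (S - {a, k})"
  then obtain c where c: "c \<in> S - {a, k}" "t = cycle_of_list [a, k, c]" by blast
  then have "distinct [a, k, c]" using assms by auto
  then show "t \<in> {t \<in> cycles3 S. t a = k}"
    using three_cycle_apply(1)[of a k c] cycles3I[of a k c S] c assms by auto
qed

lemma card_cycles3_move:
  assumes "finite S" "a \<in> S" "k \<in> S" "a \<noteq> k"
  shows "real (card {t \<in> cycles3 S. t a = k}) = real (card S) - 2"
proof -
  have "inj_on (\<lambda>c. cycle_of_list [a, k, c]) (S - {a, k})"
  proof (rule inj_onI)
    fix c c' assume c: "c \<in> S - {a, k}" "c' \<in> S - {a, k}"
      and eq: "cycle_of_list [a, k, c] = cycle_of_list [a, k, c']"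
    have "distinct [a, k, c]" "distinct [a, k, c']" using c assms by auto
    from three_cycle_apply(2)[OF this(1)] three_cycle_apply(2)[OF this(2)] eq show "c = c'" by metis
  qed
  then have "card {t \<in> cycles3 S. t a = k} = card (S - {a, k})"
    unfolding cycles3_move[OF assms(2-)] by (rule card_image)
  moreover have "card {a, k} \<le> card S" using assms by (intro card_mono) auto
  ultimately show ?thesis using assms by (simp add: card_Diff_subset of_nat_diff)
qed

text \<open>Two points are included, where both sides vanish, since deleting a point from three
  leaves two.\<close>

lemma card_cycles3:
  assumes "finite S" "card S \<ge> 2"
  shows "real (card (cycles3 S)) = real (card S) * (real (card S) - 1) * (real (card S) - 2) / 3"
proof (cases "card S = 2")
  case True
  have "cycles3 S = {}"
  proof (rule ccontr)
    assume "cycles3 S \<noteq> {}"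
    then obtain t where "t \<in> cycles3 S" by blast
    then obtain a b c where t: "t = cycle_of_list [a, b, c]" "distinct [a, b, c]" "a \<in> S" "b \<in> S" "c \<in> S"
      by (rule cycles3E)
    have "card {a, b, c} \<le> card S" using t(3-) assms by (intro card_mono) auto
    then show False using t(2) True by simp
  qed
  then show ?thesis using True by simp
next
  case False
  then show ?thesis using assms by (intro card_cycles3_ge3) auto
qed

text \<open>The sum counts the 3-cycles taking \<open>a\<close> to \<open>inv' g j\<close>: those
  fixing \<open>a\<close> if \<open>g a = j\<close>, and \<open>card S - 2\<close> of them
  otherwise. The additive constant does not depend on \<open>j\<close>, so differences for two
  values of \<open>j\<close> are eigenfunctions.\<close>

lemma nbr_sum_indicator:
  assumes S: "finite S" "card S \<ge> 3" and aj: "a \<in> S" "j \<in> S" and g: "g \<in> even_perms S"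
  shows "nbr_sum S (\<lambda>g. if g a = j then 1 else 0) g =
    (real (card (cycles3 S)) - real (card S) * (real (card S) - 2)) * (if g a = j then 1 else 0)
      + (real (card S) - 2)"
proof -
  let ?k = "inv' g j"
  have k: "?k \<in> S" using even_perms_in[OF even_perms_inv[OF S(1) g] aj(2)] .
  have gk: "g i = j \<longleftrightarrow> i = ?k" for i using even_perms_inv_iff[OF g] .
  have "nbr_sum S (\<lambda>g. if g a = j then 1 else 0) g = (\<Sum>t\<in>cycles3 S. if t a = ?k then 1 else 0)"
    by (simp add: nbr_sum_def gk)
  also have "\<dots> = real (card {t \<in> cycles3 S. t a = ?k})"
    using finite_cycles3[OF S(1)] by (simp add: sum.If_cases Int_def)
  finally have 1: "nbr_sum S (\<lambda>g. if g a = j then 1 else 0) g = real (card {t \<in> cycles3 S. t a = ?k})" .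
  show ?thesis
  proof (cases "a = ?k")
    case True
    have "{t \<in> cycles3 S. t a = ?k} = cycles3 (S - {a})" by (simp add: cycles3_Diff True[symmetric])
    moreover have "card (S - {a}) = card S - 1" using S aj by simp
    ultimately have "real (card {t \<in> cycles3 S. t a = ?k})
        = (real (card S) - 1) * (real (card S) - 2) * (real (card S) - 3) / 3"
      using card_cycles3[of "S - {a}"] S by (simp add: of_nat_diff)
    moreover have "g a = j" using True gk by simp
    ultimately show ?thesis
      unfolding 1 card_cycles3_ge3[OF S] by (simp add: field_simps)
  next
    case False
    then have "g a \<noteq> j" using gk by simp
    then show ?thesis unfolding 1 card_cycles3_move[OF S(1) aj(1) k False] by simp
  qed
qed

subsection \<open>The Cayley graph\<close>

lemma T\<^sub>3_eq_cycles3: "T\<^sub>3 n = cycles3 {1..n}"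
proof (intro equalityI subsetI)
  fix t assume "t \<in> T\<^sub>3 n"
  then obtain cs where cs: "t = cycle_of_list cs" "distinct cs" "length cs = 3" "set cs \<subseteq> {1..n}"
    unfolding T\<^sub>3_eq_three_cycles by blast
  then obtain a b c where "cs = [a, b, c]"
    by (auto simp: numeral_3_eq_3 length_Suc_conv)
  then show "t \<in> cycles3 {1..n}" using cs cycles3I[of a b c] by simp
next
  fix t assume "t \<in> cycles3 {1..n}"
  then obtain a b c where t: "t = cycle_of_list [a, b, c]" "distinct [a, b, c]" "a \<in> {1..n}" "b \<in> {1..n}" "c \<in> {1..n}"
    by (rule cycles3E)
  then show "t \<in> T\<^sub>3 n"
    unfolding T\<^sub>3_eq_three_cycles by (intro CollectI exI[of _ "[a, b, c]"]) auto
qed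

lemma cycles3_inv:
  assumes "t \<in> cycles3 S"
  shows "\<exists>s\<in>cycles3 S. t \<circ> s = id"
proof -
  from assms obtain a b c where t: "t = cycle_of_list [a, b, c]" "distinct [a, b, c]" "a \<in> S" "b \<in> S" "c \<in> S"
    by (rule cycles3E)
  have "t \<circ> cycle_of_list [a, c, b] = id"
    unfolding t(1) using t(2) by (auto simp: fun_eq_iff transpose_def)
  moreover have "cycle_of_list [a, c, b] \<in> cycles3 S" using t by (intro cycles3I) auto
  ultimately show ?thesis by blast
qed

text \<open>Left-to-right products make \<open>t\<close> times \<open>g\<close> the function
  \<open>g \<circ> t\<close>. An unordered edge may be listed from its other end, and then the
  inverse 3-cycle is used.\<close>

lemma CAG_edge_iff:
  assumes "g \<in> even_perms {1..n}"
  shows "{g, h} \<in> snd (CAG n) \<longleftrightarrow> (\<exists>t\<in>cycles3 {1..n}. h = g \<circ> t)"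
proof
  assume "{g, h} \<in> snd (CAG n)"
  then obtain x t where xt: "t \<in> cycles3 {1..n}" "{g, h} = {x, x \<circ> t}"
    by (auto simp: CAG_def cayley_graph_def alternating_group_def T\<^sub>3_eq_cycles3)
  obtain s where s: "s \<in> cycles3 {1..n}" "t \<circ> s = id" using cycles3_inv[OF xt(1)] by blast
  from xt(2) consider "g = x" "h = x \<circ> t" | "g = x \<circ> t" "h = x" by (auto simp: doubleton_eq_iff)
  then show "\<exists>t\<in>cycles3 {1..n}. h = g \<circ> t"
  proof cases
    case 2
    then have "h = g \<circ> s" using s(2) by (simp add: comp_assoc)
    then show ?thesis using s(1) by blast
  qed (use xt in blast)
next
  assume "\<exists>t\<in>cycles3 {1..n}. h = g \<circ> t"
  then show "{g, h} \<in> snd (CAG n)"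
    using assms unfolding CAG_def cayley_graph_def alternating_group_def T\<^sub>3_eq_cycles3
    by (auto simp: alt_group_carrier even_perms_def)
qed

lemma fst_CAG: "fst (CAG n) = even_perms {1..n}"
  by (auto simp: CAG_def cayley_graph_def alternating_group_def even_perms_def alt_group_carrier)

text \<open>Distinct \<open>t\<close> give distinct neighbours \<open>g \<circ> t\<close>, so the
  nonzero entries of a row match the 3-cycles one to one.\<close>

lemma adjacency_matrix_CAG_row:
  fixes f :: "(nat \<Rightarrow> nat) \<Rightarrow> real"
  assumes vs: "distinct vs" "set vs = even_perms {1..n}" and i: "i < length vs"
  shows "(\<Sum>j<length vs. adjacency_matrix vs (snd (CAG n)) $$ (i, j) * f (vs ! j))
           = nbr_sum {1..n} f (vs ! i)"
proof -
  let ?g = "vs ! i" and ?E = "even_perms {1..n}" and ?T = "cycles3 {1..n}"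
  have g: "?g \<in> ?E" using vs i nth_mem by blast
  have "(\<Sum>j<length vs. adjacency_matrix vs (snd (CAG n)) $$ (i, j) * f (vs ! j))
      = (\<Sum>j<length vs. (\<lambda>h. if {?g, h} \<in> snd (CAG n) then f h else 0) (vs ! j))"
    using i by (intro sum.cong refl) (auto simp: adjacency_matrix_def)
  also have "\<dots> = (\<Sum>h\<in>?E. if {?g, h} \<in> snd (CAG n) then f h else 0)"
    by (rule sum.reindex_bij_betw) (use bij_betw_nth[OF vs(1) refl] vs(2) in simp)
  also have "\<dots> = (\<Sum>h | h \<in> ?E \<and> {?g, h} \<in> snd (CAG n). f h)"
    by (rule sum.inter_filter[symmetric]) (simp add: finite_even_perms)
  also have "{h \<in> ?E. {?g, h} \<in> snd (CAG n)} = (\<lambda>t. ?g \<circ> t) ` ?T"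
    using CAG_edge_iff[OF g] cycles3_subset[of "{1..n}"] even_perms_comp[OF _ g] by auto
  also have "(\<Sum>h\<in>(\<lambda>t. ?g \<circ> t) ` ?T. f h) = nbr_sum {1..n} f ?g"
    unfolding nbr_sum_def
    by (subst sum.reindex) (use even_perms_inj[OF g] in \<open>auto simp: inj_on_def fun_eq_iff\<close>)
  finally show ?thesis .
qed

lemma two_choose_three: "2 * real (n choose 3) = real n * (real n - 1) * (real n - 2) / 3"
  by (simp add: binomial_gbinomial gbinomial_prod_rev numeral_3_eq_3 fact_numeral field_simps)

theorem theorem3p4:
  fixes n :: nat
  assumes "n \<ge> 3"
  shows "graph_eigenvalue 1 (CAG n) = 2 * real (n choose 3) \<and>
         graph_eigenvalue 2 (CAG n) = 1 / 3 * real n * (real n - 2) * (real n - 4)"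
proof -
  define S where "S = {1..n}"
  define d where "d = real (card (cycles3 S))"
  define l where "l = d - real n * (real n - 2)"
  have S: "finite S" "card S = n" "card S \<ge> 3" using assms by (simp_all add: S_def)
  have ld: "l < d" using assms by (simp add: l_def)
  have d_eq: "d = 2 * real (n choose 3)"
    using card_cycles3_ge3[OF S(1,3)] S(2) by (simp add: d_def two_choose_three)
  have l_eq: "l = 1 / 3 * real n * (real n - 2) * (real n - 4)"
    unfolding l_def d_eq two_choose_three by (simp add: field_simps)
  obtain vs where vs: "set vs = even_perms S" "distinct vs"
    using finite_distinct_list[OF finite_even_perms[OF S(1)]] by blast
  define A where "A = adjacency_matrix vs (snd (CAG n))"
  define N where "N = length vs"
  \<comment> \<open>\<open>idx\<close> inverts the enumeration, so that vectors can be read as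
    functions of permutations.\<close>
  define idx where "idx = inv_into {..<N} ((!) vs)"
  have idx: "idx (vs ! i) = i" if "i < N" for i
    unfolding idx_def using that vs(2) by (intro inv_into_f_f) (auto simp: N_def inj_on_nth)
  have nth: "\<exists>i<N. g = vs ! i" if "g \<in> even_perms S" for g
    using that vs(1) by (metis in_set_conv_nth N_def)
  have nth_in: "vs ! i \<in> even_perms S" if "i < N" for i
    using that vs(1) by (metis nth_mem N_def)
  have A: "A \<in> carrier_mat N N" by (simp add: A_def N_def adjacency_matrix_def)
  have row: "(\<Sum>j<N. A $$ (i, j) * f (vs ! j)) = nbr_sum S f (vs ! i)" if "i < N" for i f
    using adjacency_matrix_CAG_row[OF vs(2) _ , of n i f] vs(1) that by (simp add: A_def N_def S_def)
  define p where "p = char_poly A"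
  have p0: "p \<noteq> 0" using degree_monic_char_poly[OF A] by (auto simp: p_def)
  have root: "x \<in># proots p \<longleftrightarrow> eigenvalue A x" for x
    using p0 eigenvalue_root_char_poly[OF A] by (simp add: p_def)

  have l_root: "l \<in># proots p"
  proof -
    \<comment> \<open>Taking the difference cancels the additive constants of
      \<open>nbr_sum_indicator\<close>; \<open>f id = 1\<close> shows that \<open>f\<close> is not
      zero.\<close>
    define f where "f g = (if g 1 = (1 :: nat) then 1 else 0) - (if g 1 = (2 :: nat) then 1 else 0 :: real)"
      for g :: "nat \<Rightarrow> nat"
    have eig: "nbr_sum S f g = l * f g" if g: "g \<in> even_perms S" for g
    proof -
      have "nbr_sum S f g = nbr_sum S (\<lambda>g. if g 1 = 1 then 1 else 0) g - nbr_sum S (\<lambda>g. if g 1 = 2 then 1 else 0) g"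
        by (simp add: nbr_sum_def f_def sum_subtractf)
      also have "\<dots> = l * f g"
        using nbr_sum_indicator[OF S(1,3) _ _ g, of 1 1] nbr_sum_indicator[OF S(1,3) _ _ g, of 1 2] assms
        by (simp add: S_def f_def l_def d_def)
      finally show ?thesis .
    qed
    define v where "v = vec N (\<lambda>i. f (vs ! i))"
    obtain i where i: "i < N" "id = vs ! i" using nth[OF even_perms_id] by blast
    then have "v $ i \<noteq> 0\<^sub>v N $ i" by (simp add: v_def f_def i(2)[symmetric])
    then have "v \<noteq> 0\<^sub>v N" by auto
    moreover have "A *\<^sub>v v = l \<cdot>\<^sub>v v"
    proof (rule eq_vecI)
      fix i assume "i < dim_vec (l \<cdot>\<^sub>v v)"
      then have i: "i < N" by (simp add: v_def)
      have "(A *\<^sub>v v) $ i = (\<Sum>j<N. A $$ (i, j) * f (vs ! j))"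
        using i A by (simp add: v_def scalar_prod_def atLeast0LessThan)
      then show "(A *\<^sub>v v) $ i = (l \<cdot>\<^sub>v v) $ i"
        using row[OF i] eig[OF nth_in[OF i]] i by (simp add: v_def)
    qed (use A in \<open>simp add: v_def\<close>)
    ultimately have "eigenvector A v l" using A by (simp add: eigenvector_def v_def)
    then show ?thesis unfolding root eigenvalue_def by blast
  qed

  have le: "x \<le> l" if x: "x \<in># proots p" "x \<noteq> d" for x
  proof -
    obtain v where v: "v \<in> carrier_vec N" "v \<noteq> 0\<^sub>v N" "A *\<^sub>v v = x \<cdot>\<^sub>v v"
      using x(1) A unfolding root eigenvalue_def eigenvector_def by auto
    define f where "f g = v $ idx g" for g
    have eig: "nbr_sum S f g = x * f g" if g: "g \<in> even_perms S" for g
    proof -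
      obtain i where i: "i < N" "g = vs ! i" using nth[OF g] by blast
      have "nbr_sum S f g = (\<Sum>j<N. A $$ (i, j) * v $ j)"
        unfolding i(2) row[OF i(1), symmetric] by (intro sum.cong refl) (simp add: f_def idx)
      also have "\<dots> = (A *\<^sub>v v) $ i"
        using i A v(1) by (simp add: scalar_prod_def atLeast0LessThan)
      finally show ?thesis using v i by (simp add: f_def idx)
    qed
    obtain i where i: "i < N" "v $ i \<noteq> 0"
      using v(1,2) by (metis carrier_vecD eq_vecI index_zero_vec)
    \<comment> \<open>The eigenvalue equation summed over all \<open>g\<close>; since
      \<open>x\<close> is not \<open>d\<close>, the sum of \<open>f\<close> must vanish.\<close>
    have "d * (\<Sum>g\<in>even_perms S. f g) = x * (\<Sum>g\<in>even_perms S. f g)"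
      using sum_nbr_sum[OF S(1), of f] eig by (simp add: d_def sum_distrib_left)
    then have "(\<Sum>g\<in>even_perms S. f g) = 0" using x(2) by simp
    then have "x \<le> d - real (card S) * (real (card S) - 2)"
      unfolding d_def using i eig
      by (intro eigenvalue_le_of_sum_zero[OF S(1,3), where f = f and c = 0 and h = "vs ! i"])
        (simp_all add: nth_in, simp add: f_def idx)
    then show ?thesis by (simp add: l_def S(2))
  qed

  txt \<open>A root \<open>d\<close> of the deflated polynomial would give a function that vanishes at \<open>vs ! 0\<close>
    and satisfies the eigenvalue equation for \<open>d\<close> up to a constant, hence is constant.\<close>
  have simple: "count (proots p) d = 1"
  proof -
    obtain k where k: "N = Suc k"
      using nth[OF even_perms_id] by (metis not0_implies_Suc not_less0)
    have rs: "(\<Sum>j<Suc k. A $$ (i, j)) = d" if "i < Suc k" for i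
      using row[of i "\<lambda>_. 1"] that by (simp add: k nbr_sum_def d_def)
    define B where "B = mat k k (\<lambda>(i, j). A $$ (Suc i, Suc j) - A $$ (0, Suc j))"
    have p: "p = [:- d, 1:] * char_poly B"
      using char_poly_const_row_sum[OF A[unfolded k] rs] by (simp add: p_def B_def)
    have B: "B \<in> carrier_mat k k" by (simp add: B_def)
    have "poly (char_poly B) d \<noteq> 0"
    proof
      assume "poly (char_poly B) d = 0"
      then have "eigenvalue B d" using eigenvalue_root_char_poly[OF B] by simp
      then obtain w where w: "w \<in> carrier_vec k" "w \<noteq> 0\<^sub>v k" "B *\<^sub>v w = d \<cdot>\<^sub>v w"
        using B unfolding eigenvalue_def eigenvector_def by auto
      \<comment> \<open>Row \<open>i\<close> of \<open>B\<close> belongs to the vertex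
        \<open>vs ! Suc i\<close>, whence the shift by one; the split-off vertex
        \<open>vs ! 0\<close> gets the value 0.\<close>
      define f where "f g = (if idx g = 0 then 0 else w $ (idx g - 1))" for g
      have f_Suc: "f (vs ! Suc i) = w $ i" if "i < k" for i
        using that k by (simp_all add: f_def idx)
      have f0: "f (vs ! 0) = 0" using k by (simp add: f_def idx)
      \<comment> \<open>\<open>\<rho>\<close> is the neighbour sum at \<open>vs ! 0\<close>. As
        \<open>B\<close> has row 0 subtracted from the others, it becomes the additive constant at
        every vertex.\<close>
      define \<rho> where "\<rho> = (\<Sum>j<k. A $$ (0, Suc j) * w $ j)"
      have eig: "nbr_sum S f g = d * f g + \<rho>" if g: "g \<in> even_perms S" for g
      proof -
        obtain i where i: "i < N" "g = vs ! i" using nth[OF g] by blast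
        have *: "nbr_sum S f g = (\<Sum>j<k. A $$ (i, Suc j) * w $ j)"
          unfolding i(2) row[OF i(1), symmetric] k
          by (simp add: sum.lessThan_Suc_shift f0 f_Suc del: sum.lessThan_Suc)
        show ?thesis
        proof (cases i)
          case 0
          then show ?thesis using * i f0 by (simp add: \<rho>_def)
        next
          case (Suc i')
          then have i': "i' < k" using i k by simp
          have "d * w $ i' = (B *\<^sub>v w) $ i'" using w i' by simp
          also have "\<dots> = (\<Sum>j<k. (A $$ (Suc i', Suc j) - A $$ (0, Suc j)) * w $ j)"
            using i' w(1) B by (simp add: scalar_prod_def atLeast0LessThan B_def)
          also have "\<dots> = nbr_sum S f g - \<rho>"
            by (simp add: * Suc \<rho>_def left_diff_distrib sum_subtractf)
          finally show ?thesis using i Suc f_Suc[OF i'] by simp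
        qed
      qed
      have "w $ i = 0" if "i < k" for i
        using top_eigenfunction_const[OF S(1,3) eig[unfolded d_def], of "vs ! Suc i" "vs ! 0"]
          f_Suc[OF that] f0 that k nth_in by simp
      then have "w = 0\<^sub>v k" using w(1) by (intro eq_vecI) auto
      with w(2) show False by simp
    qed
    then have "order d (char_poly B) = 0" by (simp add: order_root)
    moreover have "order d [:- d, 1:] = 1" using order_power_n_n[of d 1] by simp
    ultimately have "order d p = 1" using p0 unfolding p by (subst order_mult) auto
    then show ?thesis using p0 by simp
  qed

  have "CAG n = (even_perms S, snd (CAG n))"
    unfolding S_def fst_CAG[symmetric] by (rule prod.collapse[symmetric])
  then have "graph_eigenvalues (CAG n) = rev (sorted_list_of_multiset (proots p))"
    using graph_eigenvalues_enumeration[OF vs(2,1)] by (metis A_def p_def)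
  then show ?thesis
    using rev_sorted_list_of_multiset_top2[OF simple l_root ld le]
    by (simp add: graph_eigenvalue_def d_eq l_eq)
qed

end
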